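(* (i) Let $W(t)=B(t)-\sigma^2(t)/2$, $t\ge0$, where $B$ is a centered Gaussian process with stationary increments and variance function $\sigma^2(t)=\mathrm{Var}(B(t))$ such that $\sigma(0)=0$. Then for any $\delta>0$ $$\mathcal{H}_W^\delta\ge\frac1\delta\max\Bigl(0,\,1-\sum_{k=1}^\infty e^{-\sigma^2(\delta k)/8}\Bigr).$$ (ii) Let $W(t)=B(t)-\Phi(1)t$, $t\ge0$, where $B$ is a Lévy process with $\Phi(1)<\infty$, where $\Phi(\theta):=\ln\mathbb{E}\{e^{\theta B(1)}\}$. Then for any $\delta>0$ $$\mathcal{H}_W^\delta\ge\frac1\delta\,\frac{\max\Bigl(0,\,1-2e^{\left(\Phi(1/2)-\frac12\Phi(1)\right)\delta}\Bigr)}{1-e^{\left(\Phi(1/2)-\frac12\Phi(1)\right)\delta}}.$$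
   Context: For $\delta>0$ the Pickands-type constant of $W$ is $$\mathcal{H}_W^\delta=\lim_{T\to\infty}\frac1T\,\mathbb{E}\Bigl\{\sup_{t\in\delta\mathbb{Z}\cap[0,T]}e^{W(t)}\Bigr\}.$$ In both cases (i) and (ii) the associated max-stable process $\xi_W(t)=\max_{i\ge1}P_ie^{W_i(t)}$, $t\ge 0$ (with $(P_i)$ the points of a Poisson point process on $(0,\infty)$ with intensity $x^{-2}dx$ and $W_i$ independent copies of $W$, independent of $(P_i)$) is stationary, and consequently this limit exists and is finite. Processes are assumed throughout to have càdlàg sample paths. *)

theory Defs
  imports "HOL-Probability.Probability"
begin

text \<open>A stochastic process indexed by $[0,\infty)$ is a family \<open>X :: real \<Rightarrow> 'a \<Rightarrow> real\<close> of which
  only the members \<open>X t\<close> with \<open>t \<ge> 0\<close> are ever used.\<close>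

definition cadlag :: "(real \<Rightarrow> real) \<Rightarrow> bool" where
  "cadlag f \<longleftrightarrow> (\<forall>t\<ge>0. (f \<longlongrightarrow> f t) (at_right t)) \<and> (\<forall>t>0. \<exists>l. (f \<longlongrightarrow> l) (at_left t))"

definition cadlag_paths :: "'a measure \<Rightarrow> (real \<Rightarrow> 'a \<Rightarrow> real) \<Rightarrow> bool" where
  "cadlag_paths M X \<longleftrightarrow> (AE \<omega> in M. cadlag (\<lambda>t. X t \<omega>))"

text \<open>The point masses are the normal distributions of variance 0.\<close>

definition gaussian_rv :: "'a measure \<Rightarrow> ('a \<Rightarrow> real) \<Rightarrow> bool" where
  "gaussian_rv M X \<longleftrightarrow> X \<in> borel_measurable M \<and>
     ((\<exists>\<mu> s. s > 0 \<and> distributed M lborel X (normal_density \<mu> s)) \<or>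
      (\<exists>\<mu>. AE \<omega> in M. X \<omega> = \<mu>))"

definition gaussian_process :: "'a measure \<Rightarrow> (real \<Rightarrow> 'a \<Rightarrow> real) \<Rightarrow> bool" where
  "gaussian_process M X \<longleftrightarrow>
     (\<forall>J a. finite J \<and> J \<subseteq> {0..} \<longrightarrow> gaussian_rv M (\<lambda>\<omega>. \<Sum>t\<in>J. a t * X t \<omega>))"

definition centered :: "'a measure \<Rightarrow> (real \<Rightarrow> 'a \<Rightarrow> real) \<Rightarrow> bool" where
  "centered M X \<longleftrightarrow> (\<forall>t\<ge>0. integrable M (X t) \<and> (\<integral>\<omega>. X t \<omega> \<partial>M) = 0)"

text \<open>The process $X(h+t)-X(h)$, $t\ge0$, has the same finite-dimensional distributions for every
  $h\ge0$.\<close>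

definition stationary_increments :: "'a measure \<Rightarrow> (real \<Rightarrow> 'a \<Rightarrow> real) \<Rightarrow> bool" where
  "stationary_increments M X \<longleftrightarrow>
     (\<forall>h\<ge>0. \<forall>J. finite J \<and> J \<subseteq> {0..} \<longrightarrow>
        distr M (PiM J (\<lambda>_. borel)) (\<lambda>\<omega>. \<lambda>t\<in>J. X (h + t) \<omega> - X h \<omega>) =
        distr M (PiM J (\<lambda>_. borel)) (\<lambda>\<omega>. \<lambda>t\<in>J. X t \<omega> - X 0 \<omega>))"

definition levy_process :: "'a measure \<Rightarrow> (real \<Rightarrow> 'a \<Rightarrow> real) \<Rightarrow> bool" where
  "levy_process M X \<longleftrightarrow>
     (\<forall>t\<ge>0. X t \<in> borel_measurable M) \<and>
     (AE \<omega> in M. X 0 \<omega> = 0) \<and>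
     (\<forall>(\<tau> :: nat \<Rightarrow> real) n. 0 \<le> \<tau> 0 \<and> strict_mono_on {..n} \<tau> \<longrightarrow>
        prob_space.indep_vars M (\<lambda>_. borel) (\<lambda>i \<omega>. X (\<tau> (Suc i)) \<omega> - X (\<tau> i) \<omega>) {..<n}) \<and>
     (\<forall>s\<ge>0. \<forall>t\<ge>0. distr M borel (\<lambda>\<omega>. X (s + t) \<omega> - X s \<omega>) = distr M borel (X t)) \<and>
     (\<forall>t\<ge>0. \<forall>\<epsilon>>0.
        ((\<lambda>s. measure M {\<omega> \<in> space M. \<bar>X s \<omega> - X t \<omega>\<bar> > \<epsilon>}) \<longlongrightarrow> 0) (at t within {0..})) \<and>
     cadlag_paths M X"

text \<open>The logarithm is real-valued, so $\Phi(\theta)<\infty$ is to be expressed as integrability of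
  $e^{\theta X(1)}$.\<close>

definition laplace_exponent :: "'a measure \<Rightarrow> (real \<Rightarrow> 'a \<Rightarrow> real) \<Rightarrow> real \<Rightarrow> real" where
  "laplace_exponent M X \<theta> = ln (\<integral>\<omega>. exp (\<theta> * X 1 \<omega>) \<partial>M)"

text \<open>For \<open>T \<ge> 0\<close> the supremum is over a finite nonempty set.\<close>

definition pickands_mean ::
    "'a measure \<Rightarrow> (real \<Rightarrow> 'a \<Rightarrow> real) \<Rightarrow> real \<Rightarrow> real \<Rightarrow> real" where
  "pickands_mean M W \<delta> T =
     1 / T * (\<integral>\<omega>. (SUP t \<in> range (\<lambda>k::int. \<delta> * of_int k) \<inter> {0..T}. exp (W t \<omega>)) \<partial>M)"

definition pickands_constant :: "'a measure \<Rightarrow> (real \<Rightarrow> 'a \<Rightarrow> real) \<Rightarrow> real \<Rightarrow> real" where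
  "pickands_constant M W \<delta> = Lim at_top (pickands_mean M W \<delta>)"

end

theory Submission
  imports Defs "HOL-Complex_Analysis.Cauchy_Integral_Formula"
begin

text \<open>Write $V_k = W(\delta k)$ and $a_n = E \max_{k \le n} e^{V_k}$. Stationarity of the max-stable
  process enters only as the shift invariance $E \max_{k \le n} e^{V_{k+1}} = a_n$. Since $V_0 = 0$, it
  gives $a_{n+1} - a_n = E (1 - \max_{k \le n} e^{V_{k+1}})^+$, which decreases to some $d$; hence
  $a_n / n \to d$ and $\mathcal H_W^\delta = d / \delta$. The bound $(1 - x)^+ \ge 1 - \sqrt x$ yields
  $d \ge 1 - \sum_{k \ge 1} E e^{V_k / 2}$, and these half moments are explicit in both cases.

  For shift invariance write $\max_{k \le n} e^{V_{k+1}} = e^{V_1} \max_{k \le n} e^{V_{k+1} - V_1}$ with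
  $E e^{V_1} = 1$. In the Levy case the two factors are independent. In the Gaussian case the tilt by
  $e^{V_1}$ turns the law of $(V_{k+1} - V_1)_k$ into that of $(V_k)_k$, as a comparison of Laplace
  transforms shows.\<close>

section \<open>Uniqueness of multivariate Laplace transforms\<close>

text \<open>The grid values of the Gaussian process may have a singular covariance matrix, so the
  change of measure cannot be carried out on joint densities. What is known is the law of each
  linear combination, and a joint Laplace transform asks for exactly that. Characteristic functions
  of the tilted law would require integrals of exponentials of complex Gaussian variables; going
  through moments keeps all computations real. In (1 - x)^+ \<ge> 1 - x^r any power 0 < r \<le> 1 is
  possible. A Gaussian half moment is the case r = 1/2 of exp (r (r - 1) \<sigma>^2 / 2), and 1/2
  minimises r (r - 1); this is the origin of the 8. For a Levy process the half moments at the times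
  \<delta> k are powers q^k of q = exp ((\<Phi>(1/2) - \<Phi>(1)/2) \<delta>), and 1 - q / (1 - q) =
  (1 - 2 q) / (1 - q). To know them at real times one needs the logarithm of the moment generating
  function to be linear in time. Independent stationary increments give additivity only, which
  leaves the pathological solutions of Cauchy's equation; stochastic continuity at 0 excludes
  these.\<close>

lemma exp_integral_sums:
  fixes \<mu> :: "real measure" and z :: complex
  assumes [measurable_cong]: "sets \<mu> = sets borel"
    and int: "\<And>t. integrable \<mu> (\<lambda>x. exp (t * x))"
  shows "(\<lambda>n. complex_of_real ((\<integral>x. x ^ n \<partial>\<mu>) / fact n) * z ^ n) sums
           (\<integral>x. exp (z * complex_of_real x) \<partial>\<mu>)"
proof -
  define f where "f n x = (z * complex_of_real x) ^ n /\<^sub>R fact n" for n x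
  \<comment> \<open>The two exponentials dominate exp (norm z * |x|) and with it all partial sums of
    the norms. This single bound gives the integrability of each term and the interchange of sum and
    integral.\<close>
  define g where "g x = exp (norm z * x) + exp (- norm z * x)" for x
  have g: "integrable \<mu> g"
    unfolding g_def by (intro Bochner_Integration.integrable_add int)
  have exp_abs: "exp (norm z * \<bar>x\<bar>) \<le> g x" for x
    by (cases "x \<ge> 0") (auto simp: g_def)
  have norm_f: "norm (f n x) = (norm z * \<bar>x\<bar>) ^ n /\<^sub>R fact n" for n x
    by (simp add: f_def norm_power norm_mult)
  have partial: "(\<Sum>n<k. norm (f n x)) \<le> g x" for k x
  proof -
    have "(\<Sum>n<k. (norm z * \<bar>x\<bar>) ^ n /\<^sub>R fact n) \<le> exp (norm z * \<bar>x\<bar>)"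
      unfolding exp_def by (rule sum_le_suminf[OF summable_exp_generic]) auto
    then show ?thesis
      unfolding norm_f using exp_abs[of x] by simp
  qed
  have [measurable]: "f n \<in> borel_measurable \<mu>" for n
    unfolding f_def by measurable
  have g_nonneg: "0 \<le> g x" for x
    by (simp add: g_def)
  have f_int: "integrable \<mu> (f n)" for n
  proof (rule Bochner_Integration.integrable_bound[OF g])
    show "AE x in \<mu>. norm (f n x) \<le> norm (g x)"
    proof (rule AE_I2)
      fix x
      have "norm (f n x) \<le> (\<Sum>i<Suc n. norm (f i x))"
        by (simp add: sum_nonneg)
      then show "norm (f n x) \<le> norm (g x)"
        using partial[of x "Suc n"] g_nonneg[of x] by simp
    qed
  qed simp
  have "summable (\<lambda>n. \<integral>x. norm (f n x) \<partial>\<mu>)"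
  proof (rule summableI_nonneg_bounded)
    fix k
    have "(\<Sum>n<k. \<integral>x. norm (f n x) \<partial>\<mu>) = (\<integral>x. (\<Sum>n<k. norm (f n x)) \<partial>\<mu>)"
      using f_int by (subst Bochner_Integration.integral_sum) auto
    also have "\<dots> \<le> (\<integral>x. g x \<partial>\<mu>)"
      using f_int g partial by (intro integral_mono) auto
    finally show "(\<Sum>n<k. \<integral>x. norm (f n x) \<partial>\<mu>) \<le> (\<integral>x. g x \<partial>\<mu>)" .
  qed simp
  moreover have "AE x in \<mu>. summable (\<lambda>n. norm (f n x))"
    by (intro AE_I2 summableI_nonneg_bounded[OF _ partial]) simp
  ultimately have "(\<lambda>n. \<integral>x. f n x \<partial>\<mu>) sums (\<integral>x. (\<Sum>n. f n x) \<partial>\<mu>)"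
    using f_int by (intro sums_integral) auto
  moreover have "(\<Sum>n. f n x) = exp (z * complex_of_real x)" for x
    by (simp add: f_def exp_def)
  moreover have "(\<integral>x. f n x \<partial>\<mu>) = complex_of_real ((\<integral>x. x ^ n \<partial>\<mu>) / fact n) * z ^ n" for n
  proof -
    have "(\<integral>x. f n x \<partial>\<mu>) = (\<integral>x. (z ^ n / fact n) * complex_of_real (x ^ n) \<partial>\<mu>)"
      by (intro Bochner_Integration.integral_cong)
         (auto simp: f_def power_mult_distrib scaleR_conv_of_real field_simps)
    also have "\<dots> = (z ^ n / fact n) * complex_of_real (\<integral>x. x ^ n \<partial>\<mu>)"
      by (subst integral_mult_right_zero, subst integral_complex_of_real) simp
    finally show ?thesis
      by simp
  qed
  ultimately show ?thesis
    by simp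
qed

text \<open>Both transforms are everywhere convergent power series in t with coefficients moment
  over factorial. The difference of the two series vanishes identically, and zeros of a nontrivial
  power series are isolated.\<close>

lemma laplace_moments_eq:
  fixes \<mu> \<nu> :: "real measure"
  assumes [measurable_cong]: "sets \<mu> = sets borel" "sets \<nu> = sets borel"
    and int: "\<And>t. integrable \<mu> (\<lambda>x. exp (t * x))" "\<And>t. integrable \<nu> (\<lambda>x. exp (t * x))"
    and eq: "\<And>t. (\<integral>x. exp (t * x) \<partial>\<mu>) = (\<integral>x. exp (t * x) \<partial>\<nu>)"
  shows "(\<integral>x. x ^ n \<partial>\<mu>) = (\<integral>x. x ^ n \<partial>\<nu>)"
proof -
  define a where "a n = ((\<integral>x. x ^ n \<partial>\<mu>) - (\<integral>x. x ^ n \<partial>\<nu>)) / fact n" for n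
  have *: "(\<lambda>n. (\<integral>x. x ^ n \<partial>\<kappa>) / fact n * t ^ n) sums (\<integral>x. exp (t * x) \<partial>\<kappa>)"
    if "sets \<kappa> = sets borel" "\<And>t. integrable \<kappa> (\<lambda>x. exp (t * x))" for t and \<kappa> :: "real measure"
  proof -
    have "(\<integral>x. exp (complex_of_real t * complex_of_real x) \<partial>\<kappa>)
        = complex_of_real (\<integral>x. exp (t * x) \<partial>\<kappa>)"
      by (subst integral_complex_of_real[symmetric]) (simp add: exp_of_real flip: of_real_mult)
    then have "(\<lambda>n. complex_of_real ((\<integral>x. x ^ n \<partial>\<kappa>) / fact n * t ^ n)) sums
        complex_of_real (\<integral>x. exp (t * x) \<partial>\<kappa>)"
      using exp_integral_sums[OF that, of "complex_of_real t"] by simp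
    then show ?thesis
      by (simp only: sums_of_real_iff)
  qed
  have sums: "(\<lambda>n. a n * (t - 0) ^ n) sums 0" for t
    using sums_diff[OF *[OF assms(1) int(1), of t] *[OF assms(2) int(2), of t]]
    unfolding eq[of t] diff_self by (simp add: a_def diff_divide_distrib left_diff_distrib)
  \<comment> \<open>\<open>powser_0_nonzero\<close> asks for a nonzero coefficient of positive
    index, so the constant term is read off separately at 0.\<close>
  have "a n = 0"
  proof (cases "n = 0")
    case True
    have "(\<lambda>n. a n * 0 ^ n) sums a 0"
      by (rule powser_sums_zero)
    moreover have "(\<lambda>n. a n * 0 ^ n) sums 0"
      using sums[of 0] by simp
    ultimately show ?thesis
      unfolding True by (rule sums_unique2)
  next
    case False
    show ?thesis
    proof (rule ccontr)
      assume "a n \<noteq> 0"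
      show False
      proof (rule powser_0_nonzero[of 1 0 a "\<lambda>_. 0" n])
        fix s :: real
        assume "0 < s" "\<And>z::real. z \<in> cball 0 s - {0} \<Longrightarrow> (0::real) \<noteq> 0"
        from this(2)[of s] this(1) show False
          by simp
      qed (use sums \<open>a n \<noteq> 0\<close> False in auto)
    qed
  qed
  then show ?thesis
    by (simp add: a_def)
qed

text \<open>The Laplace transform determines the moments, and these determine the characteristic function
  through its power series.\<close>

lemma laplace_unique_real:
  fixes \<mu> \<nu> :: "real measure"
  assumes s[measurable_cong]: "sets \<mu> = sets borel" "sets \<nu> = sets borel"
    and fin: "\<And>t. (\<integral>\<^sup>+x. ennreal (exp (t * x)) \<partial>\<mu>) \<noteq> \<infinity>"
    and eq: "\<And>t. (\<integral>\<^sup>+x. ennreal (exp (t * x)) \<partial>\<mu>) = (\<integral>\<^sup>+x. ennreal (exp (t * x)) \<partial>\<nu>)"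
  shows "\<mu> = \<nu>"
proof -
  have int: "integrable \<mu> (\<lambda>x. exp (t * x))" "integrable \<nu> (\<lambda>x. exp (t * x))" for t
    using fin[of t] eq[of t] by (auto intro!: integrableI_nonneg simp: less_top)
  have eq': "(\<integral>x. exp (t * x) \<partial>\<mu>) = (\<integral>x. exp (t * x) \<partial>\<nu>)" for t
    using eq[of t] by (simp add: integral_eq_nn_integral)
  have sp: "space \<mu> = UNIV" "space \<nu> = UNIV"
    using sets_eq_imp_space_eq[OF s(1)] sets_eq_imp_space_eq[OF s(2)] by auto
  \<comment> \<open>The common mass is left arbitrary because the lemma is applied to weighted laws.
    Uniqueness of characteristic functions concerns probability measures, hence the normalisation by
    1 / r and the separate case of mass 0.\<close>
  define c where "c = emeasure \<mu> UNIV"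
  have c: "emeasure \<nu> UNIV = c" "c \<noteq> \<infinity>"
    using eq[of 0] fin[of 0] by (simp_all add: c_def sp)
  have iexp_eq: "(CLINT x|\<mu>. iexp (t * x)) = (CLINT x|\<nu>. iexp (t * x))" for t
  proof -
    have "(\<lambda>n. complex_of_real ((\<integral>x. x ^ n \<partial>\<mu>) / fact n) * (\<i> * t) ^ n) sums
        (CLINT x|\<mu>. iexp (t * x))"
      using exp_integral_sums[OF s(1) int(1), of "\<i> * t"] by (simp add: mult_ac)
    moreover have "(\<lambda>n. complex_of_real ((\<integral>x. x ^ n \<partial>\<nu>) / fact n) * (\<i> * t) ^ n) sums
        (CLINT x|\<nu>. iexp (t * x))"
      using exp_integral_sums[OF s(2) int(2), of "\<i> * t"] by (simp add: mult_ac)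
    ultimately show ?thesis
      using laplace_moments_eq[OF s int eq'] by (simp add: sums_iff)
  qed
  show ?thesis
  proof (cases "c = 0")
    case True
    show ?thesis
    proof (rule measure_eqI)
      fix A
      have "emeasure \<mu> A \<le> c" "emeasure \<nu> A \<le> c"
        using emeasure_space[of \<mu> A] emeasure_space[of \<nu> A] c by (simp_all add: c_def sp)
      with True show "emeasure \<mu> A = emeasure \<nu> A"
        by simp
    qed (simp add: s)
  next
    case False
    define r where "r = enn2real c"
    have r: "r > 0" "c = ennreal r"
      using c False by (auto simp: r_def enn2real_positive_iff less_top zero_less_iff_neq_zero)
    define P where "P \<kappa> = density \<kappa> (\<lambda>_. ennreal (1 / r))" for \<kappa> :: "real measure"
    have em: "emeasure (P \<kappa>) A = ennreal (1 / r) * emeasure \<kappa> A" if "A \<in> sets \<kappa>" for \<kappa> A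
      using that by (simp add: P_def emeasure_density_const)
    have rd: "real_distribution (P \<kappa>)" if "sets \<kappa> = sets borel" "emeasure \<kappa> UNIV = c" for \<kappa>
    proof -
      have "emeasure (P \<kappa>) (space (P \<kappa>)) = 1"
        using that r em[of UNIV \<kappa>] sets_eq_imp_space_eq[OF that(1)]
        by (simp add: P_def flip: ennreal_mult)
      then show ?thesis
        using that by (auto simp: real_distribution_def real_distribution_axioms_def P_def
            intro!: prob_spaceI)
    qed
    have "char (P \<mu>) = char (P \<nu>)"
    proof
      fix t
      show "char (P \<mu>) t = char (P \<nu>) t"
        using r iexp_eq[of t] by (simp add: char_def P_def integral_density)
    qed
    then have P: "P \<mu> = P \<nu>"
      using c by (intro Levy_uniqueness rd s) (simp_all add: c_def)
    show ?thesis
    proof (rule measure_eqI)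
      fix A assume A: "A \<in> sets \<mu>"
      have *: "emeasure \<kappa> A = ennreal r * emeasure (P \<kappa>) A" if "A \<in> sets \<kappa>" for \<kappa>
        using r by (simp add: em[OF that] mult.assoc[symmetric] flip: ennreal_mult)
      show "emeasure \<mu> A = emeasure \<nu> A"
        using A by (simp add: * s P)
    qed (simp add: s)
  qed
qed

section \<open>Joint Laplace transforms in finitely many dimensions\<close>

text \<open>Weighting by exp Y turns the transform of X at t into the joint transform of (X, Y) at
  (t, 1). Joint transforms thus determine every exponentially weighted marginal.\<close>

lemma nn_integral_exp_distr_density:
  assumes [measurable]: "X \<in> borel_measurable M" "Y \<in> borel_measurable M"
  shows "(\<integral>\<^sup>+x. ennreal (exp (t * x)) \<partial>distr (density M (\<lambda>\<omega>. ennreal (exp (Y \<omega>)))) borel X)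
       = (\<integral>\<^sup>+\<omega>. ennreal (exp (t * X \<omega> + Y \<omega>)) \<partial>M)"
proof -
  have "(\<integral>\<^sup>+x. ennreal (exp (t * x)) \<partial>distr (density M (\<lambda>\<omega>. ennreal (exp (Y \<omega>)))) borel X)
      = (\<integral>\<^sup>+\<omega>. ennreal (exp (t * X \<omega>)) \<partial>density M (\<lambda>\<omega>. ennreal (exp (Y \<omega>))))"
    by (subst nn_integral_distr) auto
  also have "\<dots> = (\<integral>\<^sup>+\<omega>. ennreal (exp (t * X \<omega> + Y \<omega>)) \<partial>M)"
    by (subst nn_integral_density) (auto intro!: nn_integral_cong simp: exp_add ennreal_mult mult.commute)
  finally show ?thesis .
qed

text \<open>The two weights, the indicator of the event and the exponential, can be applied in
  either order. Read one way this is a transform under a restricted measure, read the other way a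
  value of a weighted law.\<close>

lemma nn_integral_density_indicator:
  assumes [measurable]: "X \<in> borel_measurable M" "Y \<in> borel_measurable M" "A \<in> sets borel"
  shows "(\<integral>\<^sup>+\<omega>. ennreal (exp (Y \<omega>)) \<partial>density M (\<lambda>\<omega>. indicator A (X \<omega>)))
       = emeasure (distr (density M (\<lambda>\<omega>. ennreal (exp (Y \<omega>)))) borel X) A"
proof -
  have "(\<integral>\<^sup>+\<omega>. ennreal (exp (Y \<omega>)) \<partial>density M (\<lambda>\<omega>. indicator A (X \<omega>)))
      = (\<integral>\<^sup>+\<omega>. ennreal (exp (Y \<omega>)) * indicator (X -` A \<inter> space M) \<omega> \<partial>M)"
    by (subst nn_integral_density) (auto intro!: nn_integral_cong simp: indicator_def)
  also have "\<dots> = emeasure (distr (density M (\<lambda>\<omega>. ennreal (exp (Y \<omega>)))) borel X) A"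
    by (simp add: emeasure_distr emeasure_density)
  finally show ?thesis .
qed

lemma emeasure_density_indicator:
  assumes "finite I"
    and [measurable]: "X k \<in> borel_measurable M" "\<And>i. i \<in> I \<Longrightarrow> X i \<in> borel_measurable M"
      "A k \<in> sets borel" "\<And>i. i \<in> I \<Longrightarrow> A i \<in> sets borel"
  shows "emeasure (density M (\<lambda>\<omega>. indicator (A k) (X k \<omega>))) {\<omega> \<in> space M. \<forall>i\<in>I. X i \<omega> \<in> A i}
       = emeasure M {\<omega> \<in> space M. X k \<omega> \<in> A k \<and> (\<forall>i\<in>I. X i \<omega> \<in> A i)}"
proof -
  note [simp] = \<open>finite I\<close>
  have "emeasure (density M (\<lambda>\<omega>. indicator (A k) (X k \<omega>))) {\<omega> \<in> space M. \<forall>i\<in>I. X i \<omega> \<in> A i}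
      = (\<integral>\<^sup>+\<omega>. indicator {\<omega> \<in> space M. X k \<omega> \<in> A k \<and> (\<forall>i\<in>I. X i \<omega> \<in> A i)} \<omega> \<partial>M)"
    (is "_ = nn_integral M (indicator ?S)")
    by (subst emeasure_density; (measurable; fail)?; intro nn_integral_cong) (auto simp: indicator_def)
  also have "\<dots> = emeasure M ?S"
    by (rule nn_integral_indicator) measurable
  finally show ?thesis .
qed

text \<open>Induction on the dimension. The one-dimensional case, applied to the law of \<open>X k\<close> weighted by the
  exponential of the other coordinates, shows that the hypothesis survives restriction to
  \<open>X k \<in> A k\<close>.\<close>

lemma laplace_unique_rect:
  fixes X :: "'i \<Rightarrow> 'a \<Rightarrow> real" and Y :: "'i \<Rightarrow> 'b \<Rightarrow> real"
  assumes "finite I"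
    and "\<And>i. i \<in> I \<Longrightarrow> X i \<in> borel_measurable M" "\<And>i. i \<in> I \<Longrightarrow> Y i \<in> borel_measurable N"
    and "\<And>u. (\<integral>\<^sup>+\<omega>. ennreal (exp (\<Sum>i\<in>I. u i * X i \<omega>)) \<partial>M) \<noteq> \<infinity>"
    and "\<And>u. (\<integral>\<^sup>+\<omega>. ennreal (exp (\<Sum>i\<in>I. u i * X i \<omega>)) \<partial>M)
           = (\<integral>\<^sup>+\<omega>. ennreal (exp (\<Sum>i\<in>I. u i * Y i \<omega>)) \<partial>N)"
    and "\<And>i. i \<in> I \<Longrightarrow> A i \<in> sets borel"
  shows "emeasure M {\<omega> \<in> space M. \<forall>i\<in>I. X i \<omega> \<in> A i} = emeasure N {\<omega> \<in> space N. \<forall>i\<in>I. Y i \<omega> \<in> A i}"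
  using assms
proof (induction I arbitrary: M N rule: finite_induct)
  case empty
  from empty(4) show ?case
    by simp
next
  case (insert k I)
  note [simp] = insert.hyps
  have [measurable]: "X k \<in> borel_measurable M" "Y k \<in> borel_measurable N"
    "\<And>i. i \<in> I \<Longrightarrow> X i \<in> borel_measurable M" "\<And>i. i \<in> I \<Longrightarrow> Y i \<in> borel_measurable N"
    "A k \<in> sets borel" "\<And>i. i \<in> I \<Longrightarrow> A i \<in> sets borel"
    using insert.prems by auto
  \<comment> \<open>Restriction is encoded as a density, so that the coordinates keep their domain.
    The result is no longer a probability measure, which is why the induction runs over arbitrary M
    and N.\<close>
  define M' where "M' = density M (\<lambda>\<omega>. indicator (A k) (X k \<omega>))"
  define N' where "N' = density N (\<lambda>\<omega>. indicator (A k) (Y k \<omega>))"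
  define \<mu> where "\<mu> u = distr (density M (\<lambda>\<omega>. ennreal (exp (\<Sum>i\<in>I. u i * X i \<omega>)))) borel (X k)" for u
  define \<nu> where "\<nu> u = distr (density N (\<lambda>\<omega>. ennreal (exp (\<Sum>i\<in>I. u i * Y i \<omega>)))) borel (Y k)" for u
  have split_sum: "(\<Sum>i\<in>insert k I. (u(k := t)) i * Z i) = t * Z k + (\<Sum>i\<in>I. u i * Z i)"
    for u t and Z :: "'i \<Rightarrow> real"
  proof -
    have "(\<Sum>i\<in>I. (u(k := t)) i * Z i) = (\<Sum>i\<in>I. u i * Z i)"
      using \<open>k \<notin> I\<close> by (intro sum.cong) auto
    then show ?thesis
      by simp
  qed
  have lap: "(\<integral>\<^sup>+x. ennreal (exp (t * x)) \<partial>\<mu> u)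
        = (\<integral>\<^sup>+\<omega>. ennreal (exp (\<Sum>i\<in>insert k I. (u(k := t)) i * X i \<omega>)) \<partial>M)"
       "(\<integral>\<^sup>+x. ennreal (exp (t * x)) \<partial>\<nu> u)
        = (\<integral>\<^sup>+\<omega>. ennreal (exp (\<Sum>i\<in>insert k I. (u(k := t)) i * Y i \<omega>)) \<partial>N)" for t u
    unfolding split_sum \<mu>_def \<nu>_def by (auto intro!: nn_integral_exp_distr_density)
  have \<mu>\<nu>: "\<mu> u = \<nu> u" for u
  proof (rule laplace_unique_real)
    fix t
    show "(\<integral>\<^sup>+x. ennreal (exp (t * x)) \<partial>\<mu> u) \<noteq> \<infinity>"
      unfolding lap by (rule insert.prems)
    show "(\<integral>\<^sup>+x. ennreal (exp (t * x)) \<partial>\<mu> u) = (\<integral>\<^sup>+x. ennreal (exp (t * x)) \<partial>\<nu> u)"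
      unfolding lap by (rule insert.prems)
  qed (simp_all add: \<mu>_def \<nu>_def)
  have M': "(\<integral>\<^sup>+\<omega>. ennreal (exp (\<Sum>i\<in>I. u i * X i \<omega>)) \<partial>M') = emeasure (\<mu> u) (A k)" for u
    unfolding M'_def \<mu>_def by (rule nn_integral_density_indicator) auto
  have N': "(\<integral>\<^sup>+\<omega>. ennreal (exp (\<Sum>i\<in>I. u i * Y i \<omega>)) \<partial>N') = emeasure (\<nu> u) (A k)" for u
    unfolding N'_def \<nu>_def by (rule nn_integral_density_indicator) auto
  have "emeasure M' {\<omega> \<in> space M'. \<forall>i\<in>I. X i \<omega> \<in> A i} = emeasure N' {\<omega> \<in> space N'. \<forall>i\<in>I. Y i \<omega> \<in> A i}"
  proof (rule insert.IH)
    fix u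
    show "(\<integral>\<^sup>+\<omega>. ennreal (exp (\<Sum>i\<in>I. u i * X i \<omega>)) \<partial>M')
        = (\<integral>\<^sup>+\<omega>. ennreal (exp (\<Sum>i\<in>I. u i * Y i \<omega>)) \<partial>N')"
      unfolding M' N' \<mu>\<nu> ..
    \<comment> \<open>Finiteness survives the restriction: the total mass of \<open>\<mu> u\<close>
      is the joint transform with coefficient 0 at k.\<close>
    have "emeasure (\<mu> u) (A k) \<le> emeasure (\<mu> u) (space (\<mu> u))"
      by (rule emeasure_space)
    also have "\<dots> = (\<integral>\<^sup>+x. ennreal (exp (0 * x)) \<partial>\<mu> u)"
      by simp
    also have "\<dots> < \<infinity>"
      unfolding lap using insert.prems(3)[of "u(k := 0)"] by (simp add: less_top)
    finally show "(\<integral>\<^sup>+\<omega>. ennreal (exp (\<Sum>i\<in>I. u i * X i \<omega>)) \<partial>M') \<noteq> \<infinity>"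
      unfolding M' by simp
  qed (auto simp: M'_def N'_def)
  moreover have "emeasure M' {\<omega> \<in> space M'. \<forall>i\<in>I. X i \<omega> \<in> A i}
      = emeasure M {\<omega> \<in> space M. \<forall>i\<in>insert k I. X i \<omega> \<in> A i}"
    unfolding M'_def by (simp add: emeasure_density_indicator)
  moreover have "emeasure N' {\<omega> \<in> space N'. \<forall>i\<in>I. Y i \<omega> \<in> A i}
      = emeasure N {\<omega> \<in> space N. \<forall>i\<in>insert k I. Y i \<omega> \<in> A i}"
    unfolding N'_def by (simp add: emeasure_density_indicator)
  ultimately show ?case
    by simp
qed

lemma emeasure_distr_PiE:
  fixes Z :: "'i \<Rightarrow> 'a \<Rightarrow> real"
  assumes "finite I" "\<And>i. i \<in> I \<Longrightarrow> Z i \<in> borel_measurable K" "\<And>i. i \<in> I \<Longrightarrow> A i \<in> sets borel"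
  shows "emeasure (distr K (PiM I (\<lambda>_. borel)) (\<lambda>\<omega>. \<lambda>i\<in>I. Z i \<omega>)) (Pi\<^sub>E I A)
       = emeasure K {\<omega> \<in> space K. \<forall>i\<in>I. Z i \<omega> \<in> A i}"
proof -
  have "Pi\<^sub>E I A \<in> sets (PiM I (\<lambda>_. borel))"
    using assms by (intro sets_PiM_I_finite)
  moreover have "(\<lambda>\<omega>. \<lambda>i\<in>I. Z i \<omega>) \<in> K \<rightarrow>\<^sub>M PiM I (\<lambda>_. borel)"
    using assms by (intro measurable_restrict)
  moreover have "(\<lambda>\<omega>. \<lambda>i\<in>I. Z i \<omega>) -` Pi\<^sub>E I A \<inter> space K = {\<omega> \<in> space K. \<forall>i\<in>I. Z i \<omega> \<in> A i}"
    by (auto simp: PiE_iff)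
  ultimately show ?thesis
    by (simp add: emeasure_distr)
qed

text \<open>Rectangles are stable under intersection and generate the product sigma-algebra, so they
  determine a finite measure. Finiteness is the transform at u = 0.\<close>

lemma laplace_unique_PiM:
  fixes X :: "'i \<Rightarrow> 'a \<Rightarrow> real" and Y :: "'i \<Rightarrow> 'b \<Rightarrow> real"
  assumes I: "finite I"
    and [measurable]: "\<And>i. i \<in> I \<Longrightarrow> X i \<in> borel_measurable M" "\<And>i. i \<in> I \<Longrightarrow> Y i \<in> borel_measurable N"
    and fin: "\<And>u. (\<integral>\<^sup>+\<omega>. ennreal (exp (\<Sum>i\<in>I. u i * X i \<omega>)) \<partial>M) \<noteq> \<infinity>"
    and eq: "\<And>u. (\<integral>\<^sup>+\<omega>. ennreal (exp (\<Sum>i\<in>I. u i * X i \<omega>)) \<partial>M)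
           = (\<integral>\<^sup>+\<omega>. ennreal (exp (\<Sum>i\<in>I. u i * Y i \<omega>)) \<partial>N)"
  shows "distr M (PiM I (\<lambda>_. borel)) (\<lambda>\<omega>. \<lambda>i\<in>I. X i \<omega>) = distr N (PiM I (\<lambda>_. borel)) (\<lambda>\<omega>. \<lambda>i\<in>I. Y i \<omega>)"
proof (rule measure_eqI_PiM_finite[OF I, where M = "\<lambda>_. borel" and A = "\<lambda>_. Pi\<^sub>E I (\<lambda>_. UNIV)"])
  fix A assume A: "\<And>i. i \<in> I \<Longrightarrow> A i \<in> sets (borel :: real measure)"
  show "emeasure (distr M (PiM I (\<lambda>_. borel)) (\<lambda>\<omega>. \<lambda>i\<in>I. X i \<omega>)) (Pi\<^sub>E I A)
      = emeasure (distr N (PiM I (\<lambda>_. borel)) (\<lambda>\<omega>. \<lambda>i\<in>I. Y i \<omega>)) (Pi\<^sub>E I A)"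
    using laplace_unique_rect[OF I _ _ fin eq A] I A by (simp add: emeasure_distr_PiE)
next
  have "emeasure (distr M (PiM I (\<lambda>_. borel)) (\<lambda>\<omega>. \<lambda>i\<in>I. X i \<omega>)) (Pi\<^sub>E I (\<lambda>_. UNIV)) = emeasure M (space M)"
    using I by (simp add: emeasure_distr_PiE)
  also have "\<dots> < \<infinity>"
    using fin[of "\<lambda>_. 0"] by (simp add: less_top)
  finally show "emeasure (distr M (PiM I (\<lambda>_. borel)) (\<lambda>\<omega>. \<lambda>i\<in>I. X i \<omega>)) (Pi\<^sub>E I (\<lambda>_. UNIV)) \<noteq> \<infinity>"
    by simp
qed (use I in \<open>auto intro!: prod_algebraI_finite simp: space_PiM\<close>)

section \<open>Growth rate of the expected maximum of a shift-invariant sequence\<close>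

lemma cesaro_mean_tendsto:
  fixes D :: "nat \<Rightarrow> real"
  assumes "D \<longlonglongrightarrow> d"
  shows "(\<lambda>n. (\<Sum>i<n. D i) / real n) \<longlonglongrightarrow> d"
proof (rule LIMSEQ_I)
  fix e :: real assume "e > 0"
  then obtain N where N: "\<And>i. i \<ge> N \<Longrightarrow> \<bar>D i - d\<bar> < e / 2"
    using LIMSEQ_D[OF assms, of "e / 2"] by auto
  define C where "C = (\<Sum>i<N. \<bar>D i - d\<bar>)"
  obtain K where K: "real K > 2 * C / e"
    using reals_Archimedean2 by blast
  have "norm ((\<Sum>i<n. D i) / real n - d) < e" if "n \<ge> max (Suc N) K" for n
  proof -
    have n: "n > 0" "n \<ge> N" "real n > 2 * C / e"
      using that K by auto
    have "(\<Sum>i<n. D i) - d * real n = (\<Sum>i<n. D i - d)"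
      by (simp add: sum_subtractf)
    also have "\<bar>\<dots>\<bar> \<le> (\<Sum>i<n. \<bar>D i - d\<bar>)"
      by (rule sum_abs)
    also have "\<dots> = C + (\<Sum>i=N..<n. \<bar>D i - d\<bar>)"
      using n by (simp add: C_def lessThan_atLeast0 sum.atLeastLessThan_concat)
    also have "(\<Sum>i=N..<n. \<bar>D i - d\<bar>) \<le> (\<Sum>i=N..<n. e / 2)"
      using N by (intro sum_mono) (auto simp: less_imp_le)
    also have "\<dots> \<le> real n * (e / 2)"
      using \<open>e > 0\<close> by simp
    also have "C < real n * (e / 2)"
      using n \<open>e > 0\<close> by (simp add: field_simps)
    finally have "\<bar>(\<Sum>i<n. D i) - d * real n\<bar> < e * real n"
      by simp
    moreover have "(\<Sum>i<n. D i) / real n - d = ((\<Sum>i<n. D i) - d * real n) / real n"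
      using n by (simp add: field_simps)
    ultimately show ?thesis
      using n by (simp add: abs_divide divide_less_eq)
  qed
  then show "\<exists>no. \<forall>n\<ge>no. norm ((\<Sum>i<n. D i) / real n - d) < e"
    by blast
qed

text \<open>With x = exp v this is 1 - sqrt x \<le> (1 - x)^+: the root exceeds x for x < 1, and for
  x > 1 the left side is negative.\<close>

lemma one_minus_exp_le: "1 - exp (v / 2) \<le> max 0 (1 - exp (v::real))"
proof (cases "v \<le> 0")
  case True
  then have "exp v \<le> exp (v / 2)"
    by simp
  then show ?thesis
    by linarith
qed auto

lemma integrable_Max_exp:
  fixes V :: "nat \<Rightarrow> 'a \<Rightarrow> real"
  assumes "\<And>k. integrable M (\<lambda>\<omega>. exp (V k \<omega>))"
  shows "integrable M (\<lambda>\<omega>. MAX k\<in>{..n::nat}. exp (V k \<omega>))"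
proof (rule Bochner_Integration.integrable_bound)
  show "integrable M (\<lambda>\<omega>. \<Sum>k\<le>n. exp (V k \<omega>))"
    using assms by auto
  show "(\<lambda>\<omega>. MAX k\<in>{..n}. exp (V k \<omega>)) \<in> borel_measurable M"
    using assms by (intro borel_measurable_Max) auto
  have "norm (MAX k\<in>{..n}. exp (V k \<omega>)) \<le> norm (\<Sum>k\<le>n. exp (V k \<omega>))" for \<omega>
  proof -
    have "(MAX k\<in>{..n}. exp (V k \<omega>)) \<in> (\<lambda>k. exp (V k \<omega>)) ` {..n}"
      by (intro Max_in) auto
    then obtain j where "j \<le> n" "(MAX k\<in>{..n}. exp (V k \<omega>)) = exp (V j \<omega>)"
      by (elim imageE) auto
    then show ?thesis
      using member_le_sum[of j "{..n}" "\<lambda>k. exp (V k \<omega>)"] by (simp add: sum_nonneg)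
  qed
  then show "AE \<omega> in M. norm (MAX k\<in>{..n}. exp (V k \<omega>)) \<le> norm (\<Sum>k\<le>n. exp (V k \<omega>))"
    by simp
qed

text \<open>Not only the averages but the increments themselves converge, by monotonicity, so the
  existence of the rate and its lower bound are read off the same sequence \<open>D\<close>. The
  last conclusion is phrased with partial sums and thus involves no summability.\<close>

lemma shift_invariant_max_rate:
  fixes V :: "nat \<Rightarrow> 'a \<Rightarrow> real"
  assumes "prob_space M"
    and V0: "AE \<omega> in M. V 0 \<omega> = 0"
    and int: "\<And>k. integrable M (\<lambda>\<omega>. exp (V k \<omega>))"
    and int2: "\<And>k. integrable M (\<lambda>\<omega>. exp (V k \<omega> / 2))"
    and shift: "\<And>n::nat. (\<integral>\<omega>. (MAX k\<in>{..n}. exp (V (Suc k) \<omega>)) \<partial>M) = (\<integral>\<omega>. (MAX k\<in>{..n}. exp (V k \<omega>)) \<partial>M)"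
  obtains d where "(\<lambda>n. (\<integral>\<omega>. (MAX k\<in>{..n}. exp (V k \<omega>)) \<partial>M) / real n) \<longlonglongrightarrow> d"
    and "0 \<le> d"
    and "\<And>c. (\<And>n. c \<le> 1 - (\<Sum>k<n. \<integral>\<omega>. exp (V (Suc k) \<omega> / 2) \<partial>M)) \<Longrightarrow> c \<le> d"
proof -
  interpret prob_space M by fact
  define a where "a n = (\<integral>\<omega>. (MAX k\<in>{..n::nat}. exp (V k \<omega>)) \<partial>M)" for n
  define Z where "Z n \<omega> = (MAX k\<in>{..n::nat}. exp (V (Suc k) \<omega>))" for n \<omega>
  define D where "D n = (\<integral>\<omega>. max 0 (1 - Z n \<omega>) \<partial>M)" for n
  have Z: "integrable M (Z n)" for n
    unfolding Z_def by (intro integrable_Max_exp int)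
  then have [measurable]: "Z n \<in> borel_measurable M" for n
    by auto
  have intD: "integrable M (\<lambda>\<omega>. max 0 (1 - Z n \<omega>))" for n
    using Z by auto
  \<comment> \<open>Peeling off k = 0 leaves \<open>Z n\<close>, whose mean is \<open>a n\<close> by
    \<open>shift\<close>; what remains is max x z - z = max 0 (x - z) at x = 1.\<close>
  have step: "a (Suc n) - a n = D n" for n
  proof -
    have "(MAX k\<in>{..Suc n}. exp (V k \<omega>)) = max (exp (V 0 \<omega>)) (Z n \<omega>)" for \<omega>
      unfolding Z_def atMost_Suc_eq_insert_0 image_insert by (subst Max_insert) (auto simp: image_image)
    then have "a (Suc n) - a n = (\<integral>\<omega>. max (exp (V 0 \<omega>)) (Z n \<omega>) \<partial>M) - (\<integral>\<omega>. Z n \<omega> \<partial>M)"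
      by (simp add: a_def Z_def shift)
    also have "\<dots> = (\<integral>\<omega>. max (exp (V 0 \<omega>)) (Z n \<omega>) - Z n \<omega> \<partial>M)"
      using int[of 0] Z by simp
    also have "\<dots> = D n"
      unfolding D_def using V0 int[of 0] by (intro integral_cong_AE) auto
    finally show ?thesis .
  qed
  have a_eq: "a n = a 0 + (\<Sum>i<n. D i)" for n
  proof (induction n)
    case (Suc n)
    then show ?case
      using step[of n] by simp
  qed simp
  have "decseq D"
  proof (rule decseq_SucI)
    fix n
    have "Z n \<omega> \<le> Z (Suc n) \<omega>" for \<omega>
      unfolding Z_def by (intro Max_mono image_mono) auto
    then have "max 0 (1 - Z (Suc n) \<omega>) \<le> max 0 (1 - Z n \<omega>)" for \<omega>
      by (intro max.mono diff_mono) auto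
    then show "D (Suc n) \<le> D n"
      unfolding D_def using intD by (intro integral_mono)
  qed
  moreover have D_nonneg: "0 \<le> D n" for n
    unfolding D_def by (intro integral_nonneg_AE) auto
  ultimately obtain d where d: "D \<longlonglongrightarrow> d" "\<And>n. d \<le> D n"
    using decseq_convergent[of D 0] by blast
  have bound: "1 - (\<Sum>k<Suc n. \<integral>\<omega>. exp (V (Suc k) \<omega> / 2) \<partial>M) \<le> D n" for n
  proof -
    \<comment> \<open>The maximum is attained at some j, and its square root is one of the summands.
      There are \<open>Suc n\<close> of these because \<open>Z n\<close> runs over k = 0, ...,
      n.\<close>
    have "1 - (\<Sum>k<Suc n. exp (V (Suc k) \<omega> / 2)) \<le> max 0 (1 - Z n \<omega>)" for \<omega>
    proof -
      have "Z n \<omega> \<in> (\<lambda>k. exp (V (Suc k) \<omega>)) ` {..n}"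
        unfolding Z_def by (intro Max_in) auto
      then obtain j where j: "j \<le> n" "Z n \<omega> = exp (V (Suc j) \<omega>)"
        by auto
      then have "exp (V (Suc j) \<omega> / 2) \<le> (\<Sum>k<Suc n. exp (V (Suc k) \<omega> / 2))"
        by (intro member_le_sum) auto
      with one_minus_exp_le[of "V (Suc j) \<omega>"] show ?thesis
        unfolding j by linarith
    qed
    then have "(\<integral>\<omega>. 1 - (\<Sum>k<Suc n. exp (V (Suc k) \<omega> / 2)) \<partial>M) \<le> D n"
      unfolding D_def using int2 intD by (intro integral_mono) auto
    then show ?thesis
      using int2 by (simp add: prob_space)
  qed
  have "(\<lambda>n. a n / real n) \<longlonglongrightarrow> d"
  proof -
    have "(\<lambda>n. a 0 / real n + (\<Sum>i<n. D i) / real n) \<longlonglongrightarrow> 0 + d"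
      by (intro tendsto_add cesaro_mean_tendsto d lim_const_over_n)
    then show ?thesis
      by (subst a_eq) (simp add: add_divide_distrib)
  qed
  moreover have "0 \<le> d"
    using d(1) D_nonneg by (intro LIMSEQ_le_const) auto
  moreover have "c \<le> d" if "\<And>n. c \<le> 1 - (\<Sum>k<n. \<integral>\<omega>. exp (V (Suc k) \<omega> / 2) \<partial>M)" for c
    using d(1) order.trans[OF that bound] by (intro LIMSEQ_le_const) auto
  ultimately show ?thesis
    using that unfolding a_def by blast
qed

section \<open>From the grid sequence to the limit in continuous time\<close>

lemma grid_SUP_eq_Max:
  fixes f :: "real \<Rightarrow> real"
  assumes "\<delta> > 0" "T \<ge> 0"
  shows "(SUP t \<in> range (\<lambda>k::int. \<delta> * of_int k) \<inter> {0..T}. f t)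
       = (MAX k\<in>{..nat \<lfloor>T / \<delta>\<rfloor>}. f (\<delta> * real k))"
proof -
  have "range (\<lambda>k::int. \<delta> * of_int k) \<inter> {0..T} = (\<lambda>k. \<delta> * real k) ` {..nat \<lfloor>T / \<delta>\<rfloor>}" (is "?A = ?B")
  proof (intro equalityI subsetI)
    fix t assume "t \<in> ?A"
    then obtain k :: int where k: "t = \<delta> * of_int k" "0 \<le> \<delta> * of_int k" "\<delta> * of_int k \<le> T"
      by auto
    then have "0 \<le> k"
      using assms by (simp add: zero_le_mult_iff)
    moreover have "k \<le> \<lfloor>T / \<delta>\<rfloor>"
      using k assms by (simp add: le_floor_iff pos_le_divide_eq mult.commute)
    ultimately show "t \<in> ?B"
      using k by (intro image_eqI[of _ _ "nat k"]) auto
  next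
    fix t assume "t \<in> ?B"
    then obtain k where k: "t = \<delta> * real k" "k \<le> nat \<lfloor>T / \<delta>\<rfloor>"
      by auto
    have "int k \<le> \<lfloor>T / \<delta>\<rfloor>"
      using k assms by (simp add: le_nat_iff)
    then have "real k \<le> T / \<delta>"
      by (simp add: le_floor_iff)
    then have "\<delta> * real k \<le> T"
      using assms by (simp add: pos_le_divide_eq mult.commute)
    then show "t \<in> ?A"
      using k assms by (auto intro!: image_eqI[of _ _ "int k"])
  qed
  then show ?thesis
    by (simp add: image_image cSup_eq_Max)
qed

text \<open>The supremum up to T sees only the grid points with index at most \<open>N T\<close>, so
  the mean factors into \<open>a (N T) / N T\<close> and \<open>N T / T\<close>, and the latter
  tends to 1 / \<delta>. Convergence is stated besides the value because \<open>Lim\<close> says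
  something only when a limit exists.\<close>

lemma pickands_mean_tendsto:
  assumes "\<delta> > 0"
    and lim: "(\<lambda>n. (\<integral>\<omega>. (MAX k\<in>{..n}. exp (W (\<delta> * real k) \<omega>)) \<partial>M) / real n) \<longlonglongrightarrow> d"
  shows "(pickands_mean M W \<delta> \<longlongrightarrow> d / \<delta>) at_top" and "pickands_constant M W \<delta> = d / \<delta>"
proof -
  define a where "a n = (\<integral>\<omega>. (MAX k\<in>{..n::nat}. exp (W (\<delta> * real k) \<omega>)) \<partial>M)" for n
  define N where "N T = nat \<lfloor>T / \<delta>\<rfloor>" for T
  have "filterlim (\<lambda>T. inverse \<delta> * T) at_top at_top"
    using \<open>\<delta> > 0\<close> by (intro filterlim_tendsto_pos_mult_at_top[OF tendsto_const] filterlim_ident) auto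
  then have N_top: "filterlim N at_top at_top"
    unfolding N_def divide_inverse mult.commute[of _ "inverse \<delta>"]
    by (intro filterlim_compose[OF filterlim_nat_sequentially] filterlim_compose[OF filterlim_floor_sequentially])
  have "((\<lambda>T. real (N T) / T) \<longlongrightarrow> 1 / \<delta>) at_top"
  proof (rule tendsto_sandwich)
    show "\<forall>\<^sub>F T in at_top. 1 / \<delta> - 1 / T \<le> real (N T) / T"
      using eventually_gt_at_top[of 0]
    proof eventually_elim
      case (elim T)
      have "T / \<delta> - 1 \<le> real (N T)"
        unfolding N_def by linarith
      then have "(T / \<delta> - 1) / T \<le> real (N T) / T"
        using elim by (intro divide_right_mono) auto
      then show ?case
        using elim by (simp add: diff_divide_distrib)
    qed
    show "\<forall>\<^sub>F T in at_top. real (N T) / T \<le> 1 / \<delta>"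
      using eventually_gt_at_top[of 0]
    proof eventually_elim
      case (elim T)
      have "real (N T) \<le> T / \<delta>"
        unfolding N_def using elim \<open>\<delta> > 0\<close> by (intro of_nat_floor) auto
      with elim \<open>\<delta> > 0\<close> show ?case
        by (simp add: field_simps)
    qed
    have "((\<lambda>T::real. 1 / \<delta> - 1 / T) \<longlongrightarrow> 1 / \<delta> - 0) at_top"
      by (intro tendsto_diff tendsto_const tendsto_divide_0[OF tendsto_const]
          filterlim_at_top_imp_at_infinity filterlim_ident)
    then show "((\<lambda>T::real. 1 / \<delta> - 1 / T) \<longlongrightarrow> 1 / \<delta>) at_top"
      by simp
  qed simp
  moreover have "((\<lambda>T. a (N T) / real (N T)) \<longlongrightarrow> d) at_top"
    using lim N_top unfolding a_def by (rule filterlim_compose)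
  ultimately have "((\<lambda>T. (a (N T) / real (N T)) * (real (N T) / T)) \<longlongrightarrow> d * (1 / \<delta>)) at_top"
    by (intro tendsto_mult)
  moreover have "\<forall>\<^sub>F T in at_top. (a (N T) / real (N T)) * (real (N T) / T) = pickands_mean M W \<delta> T"
    using eventually_ge_at_top[of 0] eventually_compose_filterlim[OF eventually_gt_at_top[of 0] N_top]
  proof eventually_elim
    case (elim T)
    then have "pickands_mean M W \<delta> T = 1 / T * a (N T)"
      unfolding pickands_mean_def a_def N_def using \<open>\<delta> > 0\<close> by (simp only: grid_SUP_eq_Max)
    then show ?case
      using elim by simp
  qed
  ultimately show lim': "(pickands_mean M W \<delta> \<longlongrightarrow> d / \<delta>) at_top"
    by (simp add: filterlim_cong)
  then show "pickands_constant M W \<delta> = d / \<delta>"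
    unfolding pickands_constant_def by (intro tendsto_Lim) auto
qed

section \<open>Gaussian processes with stationary increments\<close>

lemma Max_exp_add:
  "(MAX k\<in>{..n::nat}. exp (a + b k)) = exp a * (MAX k\<in>{..n}. exp (b k :: real))"
proof -
  have "mono (\<lambda>x. exp a * x)"
    by (intro monoI mult_left_mono) auto
  from mono_Max_commute[OF this, of "(\<lambda>k. exp (b k)) ` {..n}"] show ?thesis
    by (simp add: exp_add image_image)
qed

text \<open>Completing the square: an exponential tilt moves the mean by the variance, and the
  constant left over is the moment generating function at 1.\<close>

lemma normal_density_times_exp:
  assumes "s > 0"
  shows "normal_density 0 s x * exp x = exp (s\<^sup>2 / 2) * normal_density (s\<^sup>2) s x"
proof -
  have "- x\<^sup>2 / (2 * s\<^sup>2) + x = s\<^sup>2 / 2 + - (x - s\<^sup>2)\<^sup>2 / (2 * s\<^sup>2)"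
    using assms by (simp add: field_simps power2_eq_square)
  then show ?thesis
    by (simp add: normal_density_def mult_exp_exp)
qed

text \<open>A formula in terms of the second moment covers point masses and normal densities alike,
  so degenerate linear combinations need no case distinction later. A centered point mass sits at
  0.\<close>

lemma gaussian_rv_moments:
  assumes "prob_space M" and X: "gaussian_rv M X" and "(\<integral>\<omega>. X \<omega> \<partial>M) = 0"
  shows "integrable M (\<lambda>\<omega>. (X \<omega>)\<^sup>2)" and "integrable M (\<lambda>\<omega>. exp (X \<omega>))"
    and "(\<integral>\<omega>. exp (X \<omega>) \<partial>M) = exp ((\<integral>\<omega>. (X \<omega>)\<^sup>2 \<partial>M) / 2)"
proof -
  interpret prob_space M by fact
  have [measurable]: "X \<in> borel_measurable M"
    using X by (simp add: gaussian_rv_def)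
  have "integrable M (\<lambda>\<omega>. (X \<omega>)\<^sup>2) \<and> integrable M (\<lambda>\<omega>. exp (X \<omega>)) \<and>
      (\<integral>\<omega>. exp (X \<omega>) \<partial>M) = exp ((\<integral>\<omega>. (X \<omega>)\<^sup>2 \<partial>M) / 2)"
  proof (cases "\<exists>\<mu>. AE \<omega> in M. X \<omega> = \<mu>")
    case True
    then obtain \<mu> where \<mu>: "AE \<omega> in M. X \<omega> = \<mu>"
      by blast
    have const: "integrable M (\<lambda>\<omega>. f (X \<omega>)) \<and> (\<integral>\<omega>. f (X \<omega>) \<partial>M) = f \<mu>"
      if [measurable]: "f \<in> borel_measurable borel" for f :: "real \<Rightarrow> real"
    proof -
      have "integrable M (\<lambda>\<omega>. f (X \<omega>)) \<longleftrightarrow> integrable M (\<lambda>\<omega>. f \<mu>)"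
        using \<mu> by (intro integrable_cong_AE) auto
      moreover have "(\<integral>\<omega>. f (X \<omega>) \<partial>M) = (\<integral>\<omega>. f \<mu> \<partial>M)"
        using \<mu> by (intro integral_cong_AE) auto
      ultimately show ?thesis
        by (simp add: prob_space)
    qed
    have "\<mu> = 0"
      using const[of "\<lambda>x. x"] assms(3) by simp
    then show ?thesis
      using const[of "\<lambda>x. x\<^sup>2"] const[of exp] by simp
  next
    case False
    then obtain \<mu> s where s: "s > 0" and D: "distributed M lborel X (normal_density \<mu> s)"
      using X by (auto simp: gaussian_rv_def)
    have "\<mu> = (\<integral>x. normal_density \<mu> s x * x \<partial>lborel)"
      using integral_normal_moment_nz_1[OF s] by simp
    also have "\<dots> = 0"
      using distributed_integral[OF D, of "\<lambda>x. x"] assms(3) by simp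
    finally have D0: "distributed M lborel X (normal_density 0 s)"
      using D by simp
    have sq: "has_bochner_integral lborel (\<lambda>x. normal_density 0 s x * x\<^sup>2) (s\<^sup>2)"
      using normal_moment_even[OF s, of 0 1] by simp
    have ex: "integrable lborel (\<lambda>x. normal_density 0 s x * exp x)"
      "(\<integral>x. normal_density 0 s x * exp x \<partial>lborel) = exp (s\<^sup>2 / 2)"
      using s by (simp_all add: normal_density_times_exp)
    have "integrable M (\<lambda>\<omega>. (X \<omega>)\<^sup>2)" "(\<integral>\<omega>. (X \<omega>)\<^sup>2 \<partial>M) = s\<^sup>2"
      using distributed_integrable[OF D0, of "\<lambda>x. x\<^sup>2"] distributed_integral[OF D0, of "\<lambda>x. x\<^sup>2"] sq
      by (simp_all add: has_bochner_integral_iff)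
    moreover have "integrable M (\<lambda>\<omega>. exp (X \<omega>))" "(\<integral>\<omega>. exp (X \<omega>) \<partial>M) = exp (s\<^sup>2 / 2)"
      using distributed_integrable[OF D0, of exp] distributed_integral[OF D0, of exp] ex
      by simp_all
    ultimately show ?thesis
      by simp
  qed
  then show "integrable M (\<lambda>\<omega>. (X \<omega>)\<^sup>2)" and "integrable M (\<lambda>\<omega>. exp (X \<omega>))"
    and "(\<integral>\<omega>. exp (X \<omega>) \<partial>M) = exp ((\<integral>\<omega>. (X \<omega>)\<^sup>2 \<partial>M) / 2)"
    by auto
qed

lemma integrable_mult_square_integrable:
  fixes X Y :: "'a \<Rightarrow> real"
  assumes [measurable]: "X \<in> borel_measurable M" "Y \<in> borel_measurable M"
    and "integrable M (\<lambda>\<omega>. (X \<omega>)\<^sup>2)" "integrable M (\<lambda>\<omega>. (Y \<omega>)\<^sup>2)"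
  shows "integrable M (\<lambda>\<omega>. X \<omega> * Y \<omega>)"
proof (rule Bochner_Integration.integrable_bound)
  show "integrable M (\<lambda>\<omega>. (X \<omega>)\<^sup>2 + (Y \<omega>)\<^sup>2)"
    using assms by auto
  have "\<bar>X \<omega> * Y \<omega>\<bar> \<le> (X \<omega>)\<^sup>2 + (Y \<omega>)\<^sup>2" for \<omega>
  proof -
    have "2 * (\<bar>X \<omega>\<bar> * \<bar>Y \<omega>\<bar>) \<le> (X \<omega>)\<^sup>2 + (Y \<omega>)\<^sup>2"
      using sum_squares_bound[of "\<bar>X \<omega>\<bar>" "\<bar>Y \<omega>\<bar>"] by simp
    moreover have "0 \<le> \<bar>X \<omega>\<bar> * \<bar>Y \<omega>\<bar>"
      by simp
    ultimately show ?thesis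
      unfolding abs_mult by linarith
  qed
  then show "AE \<omega> in M. norm (X \<omega> * Y \<omega>) \<le> norm ((X \<omega>)\<^sup>2 + (Y \<omega>)\<^sup>2)"
    by (intro AE_I2) (simp add: abs_of_nonneg)
qed simp

section \<open>Gaussian process on the grid\<close>

locale stationary_gaussian_grid = prob_space M for M :: "'a measure" +
  fixes B :: "real \<Rightarrow> 'a \<Rightarrow> real" and var :: "real \<Rightarrow> real" and \<delta> :: real
  assumes gaussian: "gaussian_process M B" and centered: "centered M B"
    and stationary: "stationary_increments M B"
    and var: "\<And>t. 0 \<le> t \<Longrightarrow> var t = variance (B t)" and var_0: "var 0 = 0"
    and \<delta>_pos: "\<delta> > 0"
begin

lemma B_integrable: "0 \<le> t \<Longrightarrow> integrable M (B t)"
  and B_mean: "0 \<le> t \<Longrightarrow> (\<integral>\<omega>. B t \<omega> \<partial>M) = 0"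
  using centered by (auto simp: centered_def)

lemma var_eq: "0 \<le> t \<Longrightarrow> var t = (\<integral>\<omega>. (B t \<omega>)\<^sup>2 \<partial>M)"
  by (simp add: var B_mean)

lemma gaussian_grid_sum: "gaussian_rv M (\<lambda>\<omega>. \<Sum>k\<le>m. b k * B (\<delta> * real k) \<omega>)"
proof -
  define J where "J = (\<lambda>k. \<delta> * real k) ` {..m}"
  \<comment> \<open>Coefficients of a Gaussian process are indexed by times; the floor recovers the
    grid index from the time.\<close>
  define a where "a t = b (nat \<lfloor>t / \<delta>\<rfloor>)" for t
  have "inj_on (\<lambda>k. \<delta> * real k) {..m}"
    using \<delta>_pos by (auto intro: inj_onI)
  then have "(\<Sum>t\<in>J. a t * B t \<omega>) = (\<Sum>k\<le>m. b k * B (\<delta> * real k) \<omega>)" for \<omega>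
    using \<delta>_pos by (simp add: J_def sum.reindex a_def)
  moreover have "finite J" "J \<subseteq> {0..}"
    using \<delta>_pos by (auto simp: J_def)
  ultimately show ?thesis
    using gaussian[unfolded gaussian_process_def, rule_format, of J a] by simp
qed

lemma mean_grid_sum: "(\<integral>\<omega>. (\<Sum>k\<le>m. b k * B (\<delta> * real k) \<omega>) \<partial>M) = 0"
  using \<delta>_pos by (simp add: B_integrable B_mean)

lemma gaussian_single:
  assumes "0 \<le> t"
  shows "gaussian_rv M (B t)"
  using gaussian[unfolded gaussian_process_def, rule_format, of "{t}" "\<lambda>_. 1"] assms by simp

lemma B_measurable: "0 \<le> t \<Longrightarrow> B t \<in> borel_measurable M"
  using gaussian_single by (auto simp: gaussian_rv_def)

text \<open>Vanishing mean and variance force the value 0 only almost surely, so later identities at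
  time 0 hold up to null sets.\<close>

lemma AE_B_0: "AE \<omega> in M. B 0 \<omega> = 0"
proof -
  have "integrable M (\<lambda>\<omega>. (B 0 \<omega>)\<^sup>2)"
    by (intro gaussian_rv_moments prob_space_axioms gaussian_single B_mean) simp_all
  then have "AE \<omega> in M. (B 0 \<omega>)\<^sup>2 = 0"
    using var_eq[of 0] var_0 integral_nonneg_eq_0_iff_AE[of M "\<lambda>\<omega>. (B 0 \<omega>)\<^sup>2"] by simp
  then show ?thesis
    by simp
qed

text \<open>The process restarted at time \<delta> and observed on the grid; in particular
  \<open>Y 0\<close> is identically 0.\<close>

definition Y :: "nat \<Rightarrow> 'a \<Rightarrow> real"
  where "Y k \<omega> = B (\<delta> * real (Suc k)) \<omega> - B \<delta> \<omega>"

lemma Y_measurable [measurable]: "Y k \<in> borel_measurable M"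
  unfolding Y_def using \<delta>_pos by (intro borel_measurable_diff B_measurable) auto

lemma gaussian_sum:
  shows "gaussian_rv M (\<lambda>\<omega>. c * B \<delta> \<omega> + (\<Sum>k\<le>n. u k * Y k \<omega>))" (is ?gauss)
    and "(\<integral>\<omega>. c * B \<delta> \<omega> + (\<Sum>k\<le>n. u k * Y k \<omega>) \<partial>M) = 0" (is ?mean)
proof -
  \<comment> \<open>Every increment subtracts \<open>B \<delta>\<close>, so c minus the sum of the
    coefficients is collected at grid index 1. Index 0 receives nothing.\<close>
  define b where "b j = (case j of 0 \<Rightarrow> 0 | Suc k \<Rightarrow> u k + (if k = 0 then c - (\<Sum>k\<le>n. u k) else 0))" for j
  have eq: "c * B \<delta> \<omega> + (\<Sum>k\<le>n. u k * Y k \<omega>) = (\<Sum>k\<le>Suc n. b k * B (\<delta> * real k) \<omega>)" for \<omega>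
  proof -
    have "(\<Sum>k\<le>Suc n. b k * B (\<delta> * real k) \<omega>)
        = (\<Sum>k\<le>n. u k * B (\<delta> * real (Suc k)) \<omega> + (if k = 0 then (c - (\<Sum>k\<le>n. u k)) * B \<delta> \<omega> else 0))"
      unfolding sum.atMost_Suc_shift by (simp add: b_def) (intro sum.cong; simp add: algebra_simps)
    also have "\<dots> = (\<Sum>k\<le>n. u k * B (\<delta> * real (Suc k)) \<omega>) + (c - (\<Sum>k\<le>n. u k)) * B \<delta> \<omega>"
      by (subst sum.distrib) simp
    also have "\<dots> = c * B \<delta> \<omega> + (\<Sum>k\<le>n. u k * Y k \<omega>)"
      unfolding Y_def by (simp add: right_diff_distrib left_diff_distrib sum_subtractf sum_distrib_right)
    finally show ?thesis ..
  qed
  show ?gauss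
    unfolding eq by (rule gaussian_grid_sum)
  show ?mean
    unfolding eq by (rule mean_grid_sum)
qed

lemmas gaussian_sum_moments = gaussian_rv_moments[OF prob_space_axioms gaussian_sum]

lemma Y_square_integrable: "integrable M (\<lambda>\<omega>. (Y k \<omega>)\<^sup>2)"
  and B_square_integrable: "integrable M (\<lambda>\<omega>. (B \<delta> \<omega>)\<^sup>2)"
  using gaussian_sum_moments(1)[of 0 "\<lambda>i. if i = k then 1 else 0" k]
    gaussian_sum_moments(1)[of 1 "\<lambda>_. 0" k] by (simp_all add: if_distrib[where f = "\<lambda>x. x * Y _ _"] cong: if_cong)

lemma B_\<delta>_measurable [measurable]: "B \<delta> \<in> borel_measurable M"
  using B_measurable \<delta>_pos by simp

lemma BY_integrable: "integrable M (\<lambda>\<omega>. B \<delta> \<omega> * Y k \<omega>)"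
  by (intro integrable_mult_square_integrable Y_square_integrable B_square_integrable) measurable

lemma stationary_integral:
  assumes J: "finite J" "J \<subseteq> {0..}"
    and g: "g \<in> borel_measurable (PiM J (\<lambda>_. borel))"
  shows "(\<integral>\<omega>. g (\<lambda>t\<in>J. B (\<delta> + t) \<omega> - B \<delta> \<omega>) \<partial>M) = (\<integral>\<omega>. (g (\<lambda>t\<in>J. B t \<omega> - B 0 \<omega>) :: real) \<partial>M)"
proof -
  have m: "(\<lambda>\<omega>. \<lambda>t\<in>J. B (h + t) \<omega> - B h \<omega>) \<in> M \<rightarrow>\<^sub>M PiM J (\<lambda>_. borel)" if "h \<ge> 0" for h
    using J that by (intro measurable_restrict borel_measurable_diff B_measurable) auto
  have "distr M (PiM J (\<lambda>_. borel)) (\<lambda>\<omega>. \<lambda>t\<in>J. B (\<delta> + t) \<omega> - B \<delta> \<omega>)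
      = distr M (PiM J (\<lambda>_. borel)) (\<lambda>\<omega>. \<lambda>t\<in>J. B t \<omega> - B 0 \<omega>)"
    using stationary[unfolded stationary_increments_def, rule_format, of \<delta> J] J \<delta>_pos by simp
  then have "(\<integral>x. g x \<partial>distr M (PiM J (\<lambda>_. borel)) (\<lambda>\<omega>. \<lambda>t\<in>J. B (\<delta> + t) \<omega> - B \<delta> \<omega>))
      = (\<integral>x. g x \<partial>distr M (PiM J (\<lambda>_. borel)) (\<lambda>\<omega>. \<lambda>t\<in>J. B t \<omega> - B 0 \<omega>))"
    by simp
  then show ?thesis
    using m[of \<delta>] m[of 0] \<delta>_pos g by (simp add: integral_distr)
qed

lemma var_Y: "(\<integral>\<omega>. (Y k \<omega>)\<^sup>2 \<partial>M) = var (\<delta> * real k)"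
proof -
  have "(\<integral>\<omega>. (Y k \<omega>)\<^sup>2 \<partial>M) = (\<integral>\<omega>. (B (\<delta> * real k) \<omega> - B 0 \<omega>)\<^sup>2 \<partial>M)"
    using stationary_integral[of "{\<delta> * real k}" "\<lambda>x. (x (\<delta> * real k))\<^sup>2"] \<delta>_pos
    by (simp add: Y_def distrib_left)
  also have "\<dots> = (\<integral>\<omega>. (B (\<delta> * real k) \<omega>)\<^sup>2 \<partial>M)"
    using AE_B_0 B_measurable[of 0] B_measurable[of "\<delta> * real k"] \<delta>_pos
    by (intro integral_cong_AE) auto
  finally show ?thesis
    using var_eq[of "\<delta> * real k"] \<delta>_pos by simp
qed

text \<open>Both factors are centered, so this is a covariance. It is the amount by which the tilt
  with exp (B \<delta>) moves the mean of \<open>Y k\<close>.\<close>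

definition Y_cov :: "nat \<Rightarrow> real"
  where "Y_cov k = (\<integral>\<omega>. B \<delta> \<omega> * Y k \<omega> \<partial>M)"

text \<open>Expand the square of B \<delta> + Y k. The identity explains the drift of W: half the
  variance at k + 1 splits into the normalisation of the tilt, the mean shift of \<open>Y k\<close>,
  and half the variance at k.\<close>

lemma var_Suc: "var (\<delta> * real (Suc k)) = var \<delta> + 2 * Y_cov k + var (\<delta> * real k)"
proof -
  have "var (\<delta> * real (Suc k)) = (\<integral>\<omega>. (B \<delta> \<omega>)\<^sup>2 + 2 * (B \<delta> \<omega> * Y k \<omega>) + (Y k \<omega>)\<^sup>2 \<partial>M)"
    using var_eq[of "\<delta> * real (Suc k)"] \<delta>_pos
    by (simp add: Y_def power2_eq_square algebra_simps del: of_nat_Suc)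
  also have "\<dots> = var \<delta> + 2 * Y_cov k + var (\<delta> * real k)"
    using B_square_integrable BY_integrable Y_square_integrable \<delta>_pos
    by (simp add: Y_cov_def var_Y var_eq[of \<delta>])
  finally show ?thesis .
qed

text \<open>The Cameron--Martin formula, obtained by matching Laplace transforms.\<close>

lemma tilted_law:
  "distr (density M (\<lambda>\<omega>. ennreal (exp (B \<delta> \<omega> - var \<delta> / 2)))) (PiM {..n} (\<lambda>_. borel))
      (\<lambda>\<omega>. \<lambda>k\<in>{..n}. Y k \<omega> - Y_cov k)
   = distr M (PiM {..n} (\<lambda>_. borel)) (\<lambda>\<omega>. \<lambda>k\<in>{..n}. Y k \<omega>)"
proof (rule laplace_unique_PiM)
  fix u :: "nat \<Rightarrow> real"
  define L where "L \<omega> = (\<Sum>k\<le>n. u k * Y k \<omega>)" for \<omega>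
  have [measurable]: "L \<in> borel_measurable M"
    unfolding L_def by measurable
  have L: "integrable M (\<lambda>\<omega>. (L \<omega>)\<^sup>2)" "integrable M (\<lambda>\<omega>. exp (L \<omega>))"
    "(\<integral>\<omega>. exp (L \<omega>) \<partial>M) = exp ((\<integral>\<omega>. (L \<omega>)\<^sup>2 \<partial>M) / 2)"
    using gaussian_sum_moments[of 0 u n] by (simp_all add: L_def)
  have BL: "integrable M (\<lambda>\<omega>. exp (B \<delta> \<omega> + L \<omega>))"
    "(\<integral>\<omega>. exp (B \<delta> \<omega> + L \<omega>) \<partial>M) = exp ((\<integral>\<omega>. (B \<delta> \<omega> + L \<omega>)\<^sup>2 \<partial>M) / 2)"
    using gaussian_sum_moments[of 1 u n] by (simp_all add: L_def)
  have cov: "(\<integral>\<omega>. B \<delta> \<omega> * L \<omega> \<partial>M) = (\<Sum>k\<le>n. u k * Y_cov k)"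
  proof -
    have "(\<integral>\<omega>. B \<delta> \<omega> * L \<omega> \<partial>M) = (\<integral>\<omega>. (\<Sum>k\<le>n. u k * (B \<delta> \<omega> * Y k \<omega>)) \<partial>M)"
      by (simp add: L_def sum_distrib_left mult_ac)
    also have "\<dots> = (\<Sum>k\<le>n. u k * Y_cov k)"
      using BY_integrable by (simp add: Y_cov_def)
    finally show ?thesis .
  qed
  have "(\<integral>\<omega>. (B \<delta> \<omega> + L \<omega>)\<^sup>2 \<partial>M) = (\<integral>\<omega>. (B \<delta> \<omega>)\<^sup>2 + 2 * (B \<delta> \<omega> * L \<omega>) + (L \<omega>)\<^sup>2 \<partial>M)"
    by (simp add: power2_eq_square algebra_simps)
  also have "\<dots> = var \<delta> + 2 * (\<Sum>k\<le>n. u k * Y_cov k) + (\<integral>\<omega>. (L \<omega>)\<^sup>2 \<partial>M)"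
    using B_square_integrable L(1) integrable_mult_square_integrable[OF _ _ B_square_integrable L(1)] \<delta>_pos
    by (simp add: cov var_eq[of \<delta>])
  finally have sq: "(\<integral>\<omega>. (B \<delta> \<omega> + L \<omega>)\<^sup>2 \<partial>M) = var \<delta> + 2 * (\<Sum>k\<le>n. u k * Y_cov k) + (\<integral>\<omega>. (L \<omega>)\<^sup>2 \<partial>M)" .
  have "(\<integral>\<^sup>+\<omega>. ennreal (exp (\<Sum>k\<le>n. u k * (Y k \<omega> - Y_cov k)))
          \<partial>density M (\<lambda>\<omega>. ennreal (exp (B \<delta> \<omega> - var \<delta> / 2))))
      = (\<integral>\<^sup>+\<omega>. ennreal (exp (- var \<delta> / 2 - (\<Sum>k\<le>n. u k * Y_cov k)) * exp (B \<delta> \<omega> + L \<omega>)) \<partial>M)"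
    by (subst nn_integral_density)
       (auto intro!: nn_integral_cong simp: L_def right_diff_distrib sum_subtractf mult_exp_exp algebra_simps
         simp flip: ennreal_mult)
  also have "\<dots> = ennreal (exp (- var \<delta> / 2 - (\<Sum>k\<le>n. u k * Y_cov k)) * exp ((\<integral>\<omega>. (B \<delta> \<omega> + L \<omega>)\<^sup>2 \<partial>M) / 2))"
    using BL by (subst nn_integral_eq_integral) auto
  \<comment> \<open>By \<open>sq\<close> the tilt adds var \<delta> / 2 and the covariance term to
    the exponent. The normalisation of the density cancels the first and the recentering by
    \<open>Y_cov\<close> the second.\<close>
  also have "\<dots> = ennreal (\<integral>\<omega>. exp (L \<omega>) \<partial>M)"
    unfolding L(3) sq mult_exp_exp by (simp add: field_simps)
  also have "\<dots> = (\<integral>\<^sup>+\<omega>. ennreal (exp (L \<omega>)) \<partial>M)"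
    using L by (subst nn_integral_eq_integral) auto
  finally have *: "(\<integral>\<^sup>+\<omega>. ennreal (exp (\<Sum>k\<le>n. u k * (Y k \<omega> - Y_cov k)))
          \<partial>density M (\<lambda>\<omega>. ennreal (exp (B \<delta> \<omega> - var \<delta> / 2)))) = (\<integral>\<^sup>+\<omega>. ennreal (exp (L \<omega>)) \<partial>M)" .
  then show "(\<integral>\<^sup>+\<omega>. ennreal (exp (\<Sum>k\<le>n. u k * (Y k \<omega> - Y_cov k)))
          \<partial>density M (\<lambda>\<omega>. ennreal (exp (B \<delta> \<omega> - var \<delta> / 2))))
      = (\<integral>\<^sup>+\<omega>. ennreal (exp (\<Sum>k\<le>n. u k * Y k \<omega>)) \<partial>M)"
    by (simp add: L_def)
  show "(\<integral>\<^sup>+\<omega>. ennreal (exp (\<Sum>k\<le>n. u k * (Y k \<omega> - Y_cov k)))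
          \<partial>density M (\<lambda>\<omega>. ennreal (exp (B \<delta> \<omega> - var \<delta> / 2)))) \<noteq> \<infinity>"
    unfolding * using L by (subst nn_integral_eq_integral) auto
qed auto

lemma shift_invariance:
  "(\<integral>\<omega>. (MAX k\<in>{..n}. exp (B (\<delta> * real (Suc k)) \<omega> - var (\<delta> * real (Suc k)) / 2)) \<partial>M)
   = (\<integral>\<omega>. (MAX k\<in>{..n}. exp (B (\<delta> * real k) \<omega> - var (\<delta> * real k) / 2)) \<partial>M)"
proof -
  define v where "v k = var (\<delta> * real k)" for k
  define G where "G x = (MAX k\<in>{..n}. exp (x k - v k / 2))" for x :: "nat \<Rightarrow> real"
  have G [measurable]: "G \<in> borel_measurable (PiM {..n} (\<lambda>_. borel))"
    unfolding G_def by (intro borel_measurable_Max) (auto intro!: measurable_component_singleton)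
  have G_restrict: "G (\<lambda>k\<in>{..n}. x k) = (MAX k\<in>{..n}. exp (x k - v k / 2))" for x
    unfolding G_def by (intro arg_cong[where f = Max] image_cong) auto
  let ?Q = "density M (\<lambda>\<omega>. ennreal (exp (B \<delta> \<omega> - var \<delta> / 2)))"
  have "(MAX k\<in>{..n}. exp (B (\<delta> * real (Suc k)) \<omega> - var (\<delta> * real (Suc k)) / 2))
      = exp (B \<delta> \<omega> - var \<delta> / 2) * G (\<lambda>k\<in>{..n}. Y k \<omega> - Y_cov k)" for \<omega>
  proof -
    have "B (\<delta> * real (Suc k)) \<omega> - var (\<delta> * real (Suc k)) / 2
        = (B \<delta> \<omega> - var \<delta> / 2) + (Y k \<omega> - Y_cov k - v k / 2)" for k
      unfolding var_Suc v_def Y_def by (simp add: field_simps)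
    then show ?thesis
      by (simp only: Max_exp_add G_restrict)
  qed
  then have "(\<integral>\<omega>. (MAX k\<in>{..n}. exp (B (\<delta> * real (Suc k)) \<omega> - var (\<delta> * real (Suc k)) / 2)) \<partial>M)
      = (\<integral>\<omega>. G (\<lambda>k\<in>{..n}. Y k \<omega> - Y_cov k) \<partial>?Q)"
    by (subst integral_density) (auto intro!: measurable_compose[OF _ G] measurable_restrict)
  also have "\<dots> = (\<integral>x. G x \<partial>distr ?Q (PiM {..n} (\<lambda>_. borel)) (\<lambda>\<omega>. \<lambda>k\<in>{..n}. Y k \<omega> - Y_cov k))"
    by (subst integral_distr) (auto intro!: measurable_restrict)
  also have "\<dots> = (\<integral>\<omega>. G (\<lambda>k\<in>{..n}. Y k \<omega>) \<partial>M)"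
    unfolding tilted_law by (subst integral_distr) (auto intro!: measurable_restrict)
  \<comment> \<open>The tilt only returns the untilted law of the increments \<open>Y\<close>.
    Identifying it with the law of the process started at 0 is stationarity, jointly over the grid;
    this is formulated over real times, hence \<open>J\<close> and \<open>g\<close>.\<close>
  also have "\<dots> = (\<integral>\<omega>. (MAX k\<in>{..n}. exp (B (\<delta> * real k) \<omega> - B 0 \<omega> - v k / 2)) \<partial>M)"
  proof -
    define J where "J = (\<lambda>k. \<delta> * real k) ` {..n}"
    define g where "g x = (MAX k\<in>{..n}. exp (x (\<delta> * real k) - v k / 2))" for x :: "real \<Rightarrow> real"
    have [measurable]: "(\<lambda>x. x (\<delta> * real k)) \<in> borel_measurable (PiM J (\<lambda>_. borel))" if "k \<le> n" for k
      unfolding J_def using that by (intro measurable_component_singleton) auto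
    have "g \<in> borel_measurable (PiM J (\<lambda>_. borel))"
      unfolding g_def by (intro borel_measurable_Max) auto
    moreover have "g (\<lambda>t\<in>J. x t) = (MAX k\<in>{..n}. exp (x (\<delta> * real k) - v k / 2))" for x
      unfolding g_def J_def by (intro arg_cong[where f = Max] image_cong) auto
    moreover have "finite J" "J \<subseteq> {0..}"
      using \<delta>_pos by (auto simp: J_def)
    ultimately show ?thesis
      using stationary_integral[of J g] unfolding G_restrict by (simp add: Y_def distrib_left)
  qed
  also have "\<dots> = (\<integral>\<omega>. (MAX k\<in>{..n}. exp (B (\<delta> * real k) \<omega> - v k / 2)) \<partial>M)"
    using AE_B_0 B_measurable \<delta>_pos
    by (intro integral_cong_AE) (auto intro!: borel_measurable_Max)
  finally show ?thesis
    by (simp add: v_def)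
qed

text \<open>The case r = 1 gives mean 1, and r = 1/2 gives the summand exp (- var t / 8).\<close>

lemma exp_moments:
  assumes "0 \<le> t"
  shows "integrable M (\<lambda>\<omega>. exp (r * (B t \<omega> - var t / 2)))"
    and "(\<integral>\<omega>. exp (r * (B t \<omega> - var t / 2)) \<partial>M) = exp (r * (r - 1) * var t / 2)"
proof -
  have "gaussian_rv M (\<lambda>\<omega>. r * B t \<omega>)"
    using gaussian[unfolded gaussian_process_def, rule_format, of "{t}" "\<lambda>_. r"] assms by simp
  moreover have "(\<integral>\<omega>. r * B t \<omega> \<partial>M) = 0"
    using assms by (simp add: B_mean)
  ultimately have *: "integrable M (\<lambda>\<omega>. exp (r * B t \<omega>))"
      "(\<integral>\<omega>. exp (r * B t \<omega>) \<partial>M) = exp (r\<^sup>2 * var t / 2)"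
    using gaussian_rv_moments[OF prob_space_axioms] assms by (simp_all add: power_mult_distrib var_eq)
  have eq: "exp (r * (B t \<omega> - var t / 2)) = exp (- r * var t / 2) * exp (r * B t \<omega>)" for \<omega>
    by (simp add: mult_exp_exp algebra_simps)
  show "integrable M (\<lambda>\<omega>. exp (r * (B t \<omega> - var t / 2)))"
    unfolding eq using * by simp
  show "(\<integral>\<omega>. exp (r * (B t \<omega> - var t / 2)) \<partial>M) = exp (r * (r - 1) * var t / 2)"
    unfolding eq integral_mult_right_zero *(2) by (simp only: mult_exp_exp) (simp add: power2_eq_square field_simps)
qed

end

section \<open>Levy processes\<close>

text \<open>Subtracting \<open>t * g 1\<close> gives an additive function that vanishes at the rationals. It is thus bounded
  below everywhere, hence nonnegative, hence zero.\<close>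

lemma additive_bounded_below_linear:
  fixes g :: "real \<Rightarrow> real"
  assumes add: "\<And>s t. 0 \<le> s \<Longrightarrow> 0 \<le> t \<Longrightarrow> g (s + t) = g s + g t"
    and "\<eta> > 0" and bound: "\<And>t. 0 \<le> t \<Longrightarrow> t < \<eta> \<Longrightarrow> - C \<le> g t"
    and "0 \<le> t"
  shows "g t = t * g 1"
proof -
  define h where "h t = g t - t * g 1" for t
  have h_add: "h (s + t) = h s + h t" if "0 \<le> s" "0 \<le> t" for s t
    using that by (simp add: h_def add distrib_right)
  have h_0: "h 0 = 0"
    using h_add[of 0 0] by simp
  have h_mult: "h (real n * t) = real n * h t" if "0 \<le> t" for n t
  proof (induction n)
    case (Suc n)
    have "h (real (Suc n) * t) = h (real n * t + t)"
      by (simp add: algebra_simps)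
    then show ?case
      using that Suc by (simp add: h_add distrib_right)
  qed (simp add: h_0)
  have h_nat: "h (real n) = 0" for n
    using h_mult[of 1 n] by (simp add: h_def)
  \<comment> \<open>The second summand absorbs the subtracted linear term on [0, \<eta>).\<close>
  define C' where "C' = C + \<eta> * \<bar>g 1\<bar>"
  have h_bound: "- C' \<le> h t" if "0 \<le> t" for t
  proof -
    \<comment> \<open>Since h vanishes at multiples of 1 / N, removing the largest multiple below t
      leaves a remainder s < \<eta> with the same value of h.\<close>
    obtain N where N: "N > 0" "1 / real N < \<eta>"
      using \<open>\<eta> > 0\<close> by (metis ex_inverse_of_nat_less inverse_eq_divide)
    define j where "j = nat \<lfloor>t * real N\<rfloor>"
    define s where "s = t - real j / real N"
    have "0 \<le> \<lfloor>t * real N\<rfloor>"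
      using \<open>0 \<le> t\<close> by simp
    then have "real j \<le> t * real N" "t * real N < real j + 1"
      unfolding j_def by linarith+
    then have "real j / real N \<le> t" "t < (real j + 1) / real N"
      using N by (simp_all only: pos_divide_le_eq pos_less_divide_eq of_nat_0_less_iff)
    then have s: "0 \<le> s" "s < 1 / real N"
      by (simp_all add: s_def add_divide_distrib)
    have "real N * h (real j / real N) = h (real N * (real j / real N))"
      by (rule h_mult[symmetric]) simp
    also have "\<dots> = 0"
      using N h_nat[of j] by simp
    finally have "h (real j / real N) = 0"
      using N by simp
    then have "h t = h s"
      using h_add[of s "real j / real N"] s by (simp add: s_def)
    moreover have "s * g 1 \<le> s * \<bar>g 1\<bar>" "s * \<bar>g 1\<bar> \<le> \<eta> * \<bar>g 1\<bar>"
      using s N by (intro mult_left_mono mult_right_mono; simp)+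
    ultimately show ?thesis
      using bound[of s] s N by (simp add: h_def C'_def)
  qed
  \<comment> \<open>Along the multiples n * t a negative value would grow beyond the uniform lower
    bound.\<close>
  have h_nonneg: "0 \<le> h t" if "0 \<le> t" for t
  proof (rule ccontr)
    assume "\<not> 0 \<le> h t"
    then obtain n where "C' < real n * - h t"
      using reals_Archimedean3[of "- h t"] by auto
    then show False
      using h_bound[of "real n * t"] h_mult[OF that, of n] that by simp
  qed
  \<comment> \<open>The nonnegative values at t and k - t add up to h k = 0.\<close>
  obtain k where "t \<le> real k"
    using real_arch_simple by blast
  then have "h t + h (real k - t) = 0"
    using h_add[of t "real k - t"] h_nat[of k] \<open>0 \<le> t\<close> by simp
  with h_nonneg[of t] h_nonneg[of "real k - t"] \<open>0 \<le> t\<close> \<open>t \<le> real k\<close> have "h t = 0"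
    by simp
  then show ?thesis
    by (simp add: h_def)
qed

section \<open>Exponential moments of Levy processes\<close>

locale levy = prob_space M for M :: "'a measure" +
  fixes B :: "real \<Rightarrow> 'a \<Rightarrow> real"
  assumes levy: "levy_process M B"
begin

lemma B_measurable: "0 \<le> t \<Longrightarrow> B t \<in> borel_measurable M"
  and AE_B_0: "AE \<omega> in M. B 0 \<omega> = 0"
  and independent_increments: "0 \<le> \<tau> 0 \<Longrightarrow> strict_mono_on {..n} \<tau> \<Longrightarrow>
        indep_vars (\<lambda>_. borel) (\<lambda>i \<omega>. B (\<tau> (Suc i)) \<omega> - B (\<tau> i) \<omega>) {..<n}"
  and stationary_increments: "0 \<le> s \<Longrightarrow> 0 \<le> t \<Longrightarrow>
        distr M borel (\<lambda>\<omega>. B (s + t) \<omega> - B s \<omega>) = distr M borel (B t)"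
  and stochastic_continuity: "0 \<le> t \<Longrightarrow> 0 < \<epsilon> \<Longrightarrow>
        ((\<lambda>s. measure M {\<omega> \<in> space M. \<bar>B s \<omega> - B t \<omega>\<bar> > \<epsilon>}) \<longlongrightarrow> 0) (at t within {0..})"
  using levy by (simp_all add: levy_process_def)

text \<open>Extended-valued, so that multiplicativity in t can be proved before finiteness is
  known.\<close>

definition mgf :: "real \<Rightarrow> real \<Rightarrow> ennreal"
  where "mgf \<theta> t = (\<integral>\<^sup>+\<omega>. ennreal (exp (\<theta> * B t \<omega>)) \<partial>M)"

lemma mgf_increment:
  assumes "0 \<le> s" "0 \<le> t"
  shows "(\<integral>\<^sup>+\<omega>. ennreal (exp (\<theta> * (B (s + t) \<omega> - B s \<omega>))) \<partial>M) = mgf \<theta> t"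
proof -
  have "(\<integral>\<^sup>+\<omega>. ennreal (exp (\<theta> * (B (s + t) \<omega> - B s \<omega>))) \<partial>M)
      = (\<integral>\<^sup>+x. ennreal (exp (\<theta> * x)) \<partial>distr M borel (\<lambda>\<omega>. B (s + t) \<omega> - B s \<omega>))"
    using assms by (subst nn_integral_distr) (auto intro!: borel_measurable_diff B_measurable)
  also have "\<dots> = mgf \<theta> t"
    unfolding stationary_increments[OF assms] mgf_def
    using assms by (subst nn_integral_distr) (auto intro: B_measurable)
  finally show ?thesis .
qed

lemma mgf_0: "mgf \<theta> 0 = 1"
proof -
  have "mgf \<theta> 0 = (\<integral>\<^sup>+\<omega>. 1 \<partial>M)"
    unfolding mgf_def using AE_B_0 by (intro nn_integral_cong_AE) auto
  then show ?thesis
    by (simp add: emeasure_space_1)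
qed

text \<open>The increments over [0, s] and [s, s + t] are independent, and the second has the law of
  B t. Independence is available along strictly increasing times, so s = 0 and t = 0 are set
  apart.\<close>

lemma mgf_add:
  assumes "0 \<le> s" "0 \<le> t"
  shows "mgf \<theta> (s + t) = mgf \<theta> s * mgf \<theta> t"
proof (cases "s = 0 \<or> t = 0")
  case True
  then show ?thesis
    by (auto simp: mgf_0)
next
  case False
  define \<tau> where "\<tau> i = (if i = 0 then 0 else if i = 1 then s else s + t)" for i :: nat
  have "0 \<le> \<tau> 0"
    by (simp add: \<tau>_def)
  moreover have "strict_mono_on {..2} \<tau>"
    using assms False by (auto simp: strict_mono_on_def \<tau>_def)
  ultimately have "indep_vars (\<lambda>_. borel) (\<lambda>i \<omega>. B (\<tau> (Suc i)) \<omega> - B (\<tau> i) \<omega>) {..<2}"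
    by (rule independent_increments)
  then have ind: "indep_vars (\<lambda>_. borel) (\<lambda>i \<omega>. ennreal (exp (\<theta> * (B (\<tau> (Suc i)) \<omega> - B (\<tau> i) \<omega>)))) {..<2}"
    by (rule indep_vars_compose2) measurable
  have "mgf \<theta> (s + t) = (\<integral>\<^sup>+\<omega>. (\<Prod>i<2. ennreal (exp (\<theta> * (B (\<tau> (Suc i)) \<omega> - B (\<tau> i) \<omega>)))) \<partial>M)"
    unfolding mgf_def using AE_B_0
  proof (intro nn_integral_cong_AE, elim AE_mp, intro AE_I2 impI)
    fix \<omega> assume "B 0 \<omega> = 0"
    then show "ennreal (exp (\<theta> * B (s + t) \<omega>))
        = (\<Prod>i<2. ennreal (exp (\<theta> * (B (\<tau> (Suc i)) \<omega> - B (\<tau> i) \<omega>))))"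
      by (simp add: \<tau>_def numeral_2_eq_2 mult_exp_exp algebra_simps flip: ennreal_mult)
  qed
  also have "\<dots> = (\<Prod>i<2. \<integral>\<^sup>+\<omega>. ennreal (exp (\<theta> * (B (\<tau> (Suc i)) \<omega> - B (\<tau> i) \<omega>))) \<partial>M)"
    using ind by (intro indep_vars_nn_integral) auto
  also have "\<dots> = mgf \<theta> s * mgf \<theta> t"
    using mgf_increment[of 0 s \<theta>] mgf_increment[OF assms, of \<theta>] assms
    by (simp add: numeral_2_eq_2 \<tau>_def)
  finally show ?thesis .
qed

lemma mgf_nonzero:
  assumes "0 \<le> t"
  shows "mgf \<theta> t \<noteq> 0"
proof
  have [measurable]: "B t \<in> borel_measurable M"
    using assms by (rule B_measurable)
  assume "mgf \<theta> t = 0"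
  then have "AE \<omega> in M. False"
    unfolding mgf_def by (subst (asm) nn_integral_0_iff_AE) auto
  then show False
    by simp
qed

text \<open>At integers the value is a power of the value at 1. An infinite value at t would, times
  a nonzero factor, make the value at some larger integer infinite.\<close>

lemma mgf_finite:
  assumes "mgf \<theta> 1 \<noteq> \<infinity>" "0 \<le> t"
  shows "mgf \<theta> t \<noteq> \<infinity>"
proof
  assume inf: "mgf \<theta> t = \<infinity>"
  obtain n where n: "t \<le> real n"
    using real_arch_simple by blast
  have "mgf \<theta> (real n) \<noteq> \<infinity>" for n
  proof (induction n)
    case (Suc n)
    then show ?case
      using mgf_add[of "real n" 1] assms by (simp add: ennreal_mult_eq_top_iff add.commute)
  qed (simp add: mgf_0)
  then show False
    using mgf_add[of t "real n - t" \<theta>] mgf_nonzero[of "real n - t" \<theta>] inf n \<open>0 \<le> t\<close>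
    by (simp add: ennreal_mult_eq_top_iff)
qed

text \<open>For small t stochastic continuity gives |B t| \<le> 1 with probability at least 1/2, and
  on this event the exponential is at least exp (- |\<theta>|). This is the regularity needed to
  pass from additivity to linearity.\<close>

lemma mgf_bounded_below:
  obtains \<eta> where "\<eta> > 0" "\<And>t. 0 \<le> t \<Longrightarrow> t < \<eta> \<Longrightarrow> ennreal (exp (- \<bar>\<theta>\<bar>) / 2) \<le> mgf \<theta> t"
proof -
  have "\<forall>\<^sub>F s in at 0 within {0..}. measure M {\<omega> \<in> space M. \<bar>B s \<omega> - B 0 \<omega>\<bar> > 1} < 1 / 2"
    using stochastic_continuity[of 0 1] by (rule order_tendstoD) auto
  then obtain \<eta> where \<eta>: "\<eta> > 0"
    "\<And>s. 0 \<le> s \<Longrightarrow> s \<noteq> 0 \<Longrightarrow> s < \<eta> \<Longrightarrow> measure M {\<omega> \<in> space M. \<bar>B s \<omega> - B 0 \<omega>\<bar> > 1} < 1 / 2"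
    unfolding eventually_at by (auto simp: dist_real_def)
  have "ennreal (exp (- \<bar>\<theta>\<bar>) / 2) \<le> mgf \<theta> s" if s: "0 \<le> s" "s < \<eta>" for s
  proof -
    have [measurable]: "B s \<in> borel_measurable M" "B 0 \<in> borel_measurable M"
      using s by (auto intro: B_measurable)
    define A where "A = {\<omega> \<in> space M. \<bar>B s \<omega> - B 0 \<omega>\<bar> > 1}"
    have [measurable]: "A \<in> sets M"
      unfolding A_def by measurable
    have "prob A < 1 / 2"
      using \<eta>(2)[of s] s by (cases "s = 0") (auto simp: A_def)
    then have "1 / 2 \<le> prob (space M - A)"
      by (simp add: prob_compl)
    then have "exp (- \<bar>\<theta>\<bar>) * (1 / 2) \<le> exp (- \<bar>\<theta>\<bar>) * prob (space M - A)"
      by (intro mult_left_mono) auto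
    then have "ennreal (exp (- \<bar>\<theta>\<bar>) / 2) \<le> ennreal (exp (- \<bar>\<theta>\<bar>)) * emeasure M (space M - A)"
      by (simp add: emeasure_eq_measure flip: ennreal_mult)
    also have "\<dots> = (\<integral>\<^sup>+\<omega>. ennreal (exp (- \<bar>\<theta>\<bar>)) * indicator (space M - A) \<omega> \<partial>M)"
      by (simp add: nn_integral_cmult_indicator)
    also have "\<dots> \<le> mgf \<theta> s"
      unfolding mgf_def using AE_B_0
    proof (intro nn_integral_mono_AE, elim AE_mp, intro AE_I2 impI)
      fix \<omega> assume \<omega>: "\<omega> \<in> space M" "B 0 \<omega> = 0"
      have "- \<bar>\<theta>\<bar> \<le> \<theta> * B s \<omega>" if "\<omega> \<notin> A"
      proof -
        have "\<bar>\<theta> * B s \<omega>\<bar> \<le> \<bar>\<theta>\<bar> * 1"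
          unfolding abs_mult using that \<omega> by (intro mult_left_mono) (auto simp: A_def)
        then show ?thesis
          by linarith
      qed
      then show "ennreal (exp (- \<bar>\<theta>\<bar>)) * indicator (space M - A) \<omega> \<le> ennreal (exp (\<theta> * B s \<omega>))"
        by (auto simp: indicator_def intro!: ennreal_leI)
    qed
    finally show ?thesis .
  qed
  with \<eta>(1) that show ?thesis
    by blast
qed

text \<open>The logarithm of the moment generating function is additive in time and bounded below
  near 0, hence linear; its slope is its value at time 1.\<close>

lemma exp_moments:
  assumes int: "integrable M (\<lambda>\<omega>. exp (\<theta> * B 1 \<omega>))" and t: "0 \<le> t"
  shows "integrable M (\<lambda>\<omega>. exp (\<theta> * B t \<omega>))"
    and "(\<integral>\<omega>. exp (\<theta> * B t \<omega>) \<partial>M) = exp (t * laplace_exponent M B \<theta>)"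
proof -
  have "mgf \<theta> 1 = ennreal (\<integral>\<omega>. exp (\<theta> * B 1 \<omega>) \<partial>M)"
    unfolding mgf_def using int by (intro nn_integral_eq_integral) auto
  then have "mgf \<theta> 1 \<noteq> \<infinity>"
    by simp
  then have fin: "mgf \<theta> s \<noteq> \<infinity>" if "0 \<le> s" for s
    using that by (rule mgf_finite)
  define m where "m s = enn2real (mgf \<theta> s)" for s
  have m: "mgf \<theta> s = ennreal (m s)" "m s > 0" if "0 \<le> s" for s
    using fin[OF that] mgf_nonzero[OF that, of \<theta>]
    by (auto simp: m_def enn2real_positive_iff less_top zero_less_iff_neq_zero)
  obtain \<eta> where \<eta>: "\<eta> > 0" "\<And>t. 0 \<le> t \<Longrightarrow> t < \<eta> \<Longrightarrow> ennreal (exp (- \<bar>\<theta>\<bar>) / 2) \<le> mgf \<theta> t"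
    using mgf_bounded_below[of \<theta>] by blast
  have "ln (m t) = t * ln (m 1)"
  proof (rule additive_bounded_below_linear[where \<eta> = \<eta> and C = "- ln (exp (- \<bar>\<theta>\<bar>) / 2)"])
    fix s t :: real assume st: "0 \<le> s" "0 \<le> t"
    then have "m (s + t) = m s * m t"
      by (simp add: m_def mgf_add enn2real_mult)
    then show "ln (m (s + t)) = ln (m s) + ln (m t)"
      using m(2) st by (simp add: ln_mult_pos)
  next
    fix t assume t: "0 \<le> t" "t < \<eta>"
    have "exp (- \<bar>\<theta>\<bar>) / 2 \<le> m t"
      using \<eta>(2)[OF t] m[OF t(1)] by (simp add: ennreal_le_iff less_imp_le)
    then show "- (- ln (exp (- \<bar>\<theta>\<bar>) / 2)) \<le> ln (m t)"
      unfolding minus_minus by (subst ln_le_cancel_iff) (use m(2)[OF t(1)] in auto)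
  qed (use \<eta> t in auto)
  then have m_eq: "m t = exp (t * ln (m 1))"
    using m(2)[OF t] by (metis exp_ln)
  have [measurable]: "B s \<in> borel_measurable M" if "0 \<le> s" for s
    using that by (rule B_measurable)
  show int_t: "integrable M (\<lambda>\<omega>. exp (\<theta> * B t \<omega>))"
    using fin[OF t] t unfolding mgf_def by (intro integrableI_nonneg) (auto simp: less_top)
  have "(\<integral>\<omega>. exp (\<theta> * B s \<omega>) \<partial>M) = m s" if "0 \<le> s" for s
    unfolding m_def mgf_def using that by (subst integral_eq_nn_integral) auto
  then show "(\<integral>\<omega>. exp (\<theta> * B t \<omega>) \<partial>M) = exp (t * laplace_exponent M B \<theta>)"
    using m_eq t by (simp add: laplace_exponent_def)
qed

section \<open>Levy increments on the grid\<close>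

lemma grid_increments_indep:
  assumes "\<delta> > 0"
  shows "indep_vars (\<lambda>_. borel)
           (\<lambda>i \<omega>. B (\<delta> * real (Suc (j + i))) \<omega> - B (\<delta> * real (j + i)) \<omega>) {..<n}"
proof -
  have "strict_mono_on {..n} (\<lambda>i. \<delta> * real (j + i))"
    using assms by (simp add: strict_mono_on_def)
  then show ?thesis
    using independent_increments[of "\<lambda>i. \<delta> * real (j + i)" n] assms by (simp only: add_Suc_right) simp
qed

text \<open>The product law does not depend on the offset j, which is what shift invariance rests
  on. \<open>Suc n\<close> keeps the index set nonempty for the product characterisation of
  independence.\<close>

lemma grid_increments_law:
  assumes "\<delta> > 0"
  shows "distr M (PiM {..<Suc n} (\<lambda>_. borel))
           (\<lambda>\<omega>. \<lambda>i\<in>{..<Suc n}. B (\<delta> * real (Suc (j + i))) \<omega> - B (\<delta> * real (j + i)) \<omega>)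
       = PiM {..<Suc n} (\<lambda>_. distr M borel (B \<delta>))"
proof -
  have "distr M borel (\<lambda>\<omega>. B (\<delta> * real (Suc k)) \<omega> - B (\<delta> * real k) \<omega>) = distr M borel (B \<delta>)" for k
    using stationary_increments[of "\<delta> * real k" \<delta>] assms by (simp add: distrib_left add.commute)
  then show ?thesis
    using grid_increments_indep[OF assms, of j "Suc n"] assms
    by (subst (asm) indep_vars_iff_distr_eq_PiM')
       (auto intro!: borel_measurable_diff B_measurable simp del: of_nat_Suc of_nat_add)
qed

lemma shift_invariance:
  fixes \<delta> :: real and n :: nat
  assumes int1: "integrable M (\<lambda>\<omega>. exp (B 1 \<omega>))" and \<delta>: "\<delta> > 0"
  defines "V \<equiv> \<lambda>k \<omega>. B (\<delta> * real k) \<omega> - laplace_exponent M B 1 * (\<delta> * real k)"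
  shows "(\<integral>\<omega>. (MAX k\<in>{..n}. exp (V (Suc k) \<omega>)) \<partial>M) = (\<integral>\<omega>. (MAX k\<in>{..n}. exp (V k \<omega>)) \<partial>M)"
proof -
  define \<phi> where "\<phi> = laplace_exponent M B 1 * \<delta>"
  define X where "X i \<omega> = B (\<delta> * real (Suc i)) \<omega> - B (\<delta> * real i) \<omega>" for i \<omega>
  have Bm [measurable]: "B (\<delta> * real k) \<in> borel_measurable M" for k
    using \<delta> by (intro B_measurable) simp
  have Xm [measurable]: "X i \<in> borel_measurable M" for i
    unfolding X_def by measurable
  have X_sum: "(\<Sum>i<k. X (j + i) \<omega>) = B (\<delta> * real (j + k)) \<omega> - B (\<delta> * real j) \<omega>" for j k \<omega>
    unfolding X_def using sum_lessThan_telescope[of "\<lambda>i. B (\<delta> * real (j + i)) \<omega>" k] by simp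
  define G where "G x = (MAX k\<in>{..n}. exp ((\<Sum>i<k. x i) - \<phi> * real k))" for x :: "nat \<Rightarrow> real"
  have G [measurable]: "G \<in> borel_measurable (PiM {..<Suc n} (\<lambda>_. borel))"
    unfolding G_def
    by (intro borel_measurable_Max borel_measurable_exp borel_measurable_diff borel_measurable_sum
        measurable_component_singleton) auto
  have G_restrict: "G (\<lambda>i\<in>{..<Suc n}. x i) = G x" for x
    unfolding G_def by (intro arg_cong[where f = Max] image_cong) auto
  have G_law: "(\<integral>\<omega>. G (\<lambda>i. X (j + i) \<omega>) \<partial>M) = (\<integral>x. G x \<partial>PiM {..<Suc n} (\<lambda>_. distr M borel (B \<delta>)))" for j
  proof -
    have "(\<integral>x. G x \<partial>PiM {..<Suc n} (\<lambda>_. distr M borel (B \<delta>)))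
        = (\<integral>\<omega>. G (\<lambda>i\<in>{..<Suc n}. X (j + i) \<omega>) \<partial>M)"
      unfolding grid_increments_law[OF \<delta>, of n j, symmetric] X_def[symmetric]
      by (subst integral_distr) (auto intro!: measurable_restrict)
    then show ?thesis
      unfolding G_restrict by simp
  qed
  have G_X: "G (\<lambda>i. X (j + i) \<omega>) = (MAX k\<in>{..n}. exp (B (\<delta> * real (j + k)) \<omega> - B (\<delta> * real j) \<omega> - \<phi> * real k))"
    for j \<omega>
    unfolding G_def X_sum ..
  have G_int: "integrable M (\<lambda>\<omega>. G (\<lambda>i. X (1 + i) \<omega>))"
    unfolding G_X
  proof (rule integrable_Max_exp)
    fix k
    have "integrable (distr M borel (B (\<delta> * real k))) exp"
      using exp_moments(1)[of 1 "\<delta> * real k"] int1 \<delta> by (subst integrable_distr_eq) auto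
    then have "integrable (distr M borel (\<lambda>\<omega>. B (\<delta> + \<delta> * real k) \<omega> - B \<delta> \<omega>)) exp"
      using stationary_increments[of \<delta> "\<delta> * real k"] \<delta> by simp
    then have "integrable M (\<lambda>\<omega>. exp (B (\<delta> + \<delta> * real k) \<omega> - B \<delta> \<omega>))"
      using \<delta> by (subst (asm) integrable_distr_eq) (auto intro!: borel_measurable_diff B_measurable)
    then have "integrable M (\<lambda>\<omega>. exp (- \<phi> * real k) * exp (B (\<delta> + \<delta> * real k) \<omega> - B \<delta> \<omega>))"
      by simp
    then show "integrable M (\<lambda>\<omega>. exp (B (\<delta> * real (1 + k)) \<omega> - B (\<delta> * real 1) \<omega> - \<phi> * real k))"
      by (simp add: mult_exp_exp distrib_left algebra_simps)
  qed
  \<comment> \<open>The drift \<Phi>(1) is chosen for this normalisation: the first factor has mean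
    1 and disappears from the product.\<close>
  have B\<delta>: "(\<integral>\<omega>. exp (X 0 \<omega> - \<phi>) \<partial>M) = 1" "integrable M (\<lambda>\<omega>. exp (X 0 \<omega> - \<phi>))"
  proof -
    have AE: "AE \<omega> in M. exp (X 0 \<omega> - \<phi>) = exp (- \<phi>) * exp (1 * B \<delta> \<omega>)"
      using AE_B_0 by eventually_elim (simp add: X_def mult_exp_exp)
    have [measurable]: "B \<delta> \<in> borel_measurable M"
      using Bm[of 1] by simp
    have "(\<integral>\<omega>. exp (X 0 \<omega> - \<phi>) \<partial>M) = (\<integral>\<omega>. exp (- \<phi>) * exp (1 * B \<delta> \<omega>) \<partial>M)"
      by (intro integral_cong_AE AE) measurable
    also have "\<dots> = 1"
    proof -
      have "(\<integral>\<omega>. exp (1 * B \<delta> \<omega>) \<partial>M) = exp \<phi>"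
        using exp_moments(2)[of 1 \<delta>] int1 \<delta> by (simp add: \<phi>_def mult.commute)
      then show ?thesis
        by (subst integral_mult_right_zero) (simp add: mult_exp_exp)
    qed
    finally show "(\<integral>\<omega>. exp (X 0 \<omega> - \<phi>) \<partial>M) = 1" .
    have "integrable M (\<lambda>\<omega>. exp (- \<phi>) * exp (1 * B \<delta> \<omega>))"
      using exp_moments(1)[of 1 \<delta>] int1 \<delta> by simp
    then show "integrable M (\<lambda>\<omega>. exp (X 0 \<omega> - \<phi>))"
      by (subst integrable_cong_AE[OF _ _ AE]) measurable
  qed
  have ind: "indep_var borel (\<lambda>\<omega>. exp (X 0 \<omega> - \<phi>)) borel (\<lambda>\<omega>. G (\<lambda>i. X (1 + i) \<omega>))"
  proof -
    \<comment> \<open>\<open>G\<close> rewritten to read the coordinates from 1 on, so that it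
      depends on a block of increments disjoint from index 0.\<close>
    define H where "H x = G (\<lambda>i. x (1 + i))" for x
    have H: "H \<in> borel_measurable (PiM {1..<Suc (Suc n)} (\<lambda>_. borel))"
      unfolding H_def G_def
      by (intro borel_measurable_Max borel_measurable_exp borel_measurable_diff borel_measurable_sum
          measurable_component_singleton) auto
    have E: "(\<lambda>x. exp (x 0 - \<phi>)) \<in> borel_measurable (PiM {0::nat} (\<lambda>_. borel))"
      by measurable
    have "indep_vars (\<lambda>_. borel) X {..<Suc (Suc n)}"
      using grid_increments_indep[OF \<delta>, of 0 "Suc (Suc n)"] unfolding X_def by simp
    then have "indep_var (PiM {0} (\<lambda>_. borel)) (\<lambda>\<omega>. \<lambda>i\<in>{0}. X i \<omega>)
        (PiM {1..<Suc (Suc n)} (\<lambda>_. borel)) (\<lambda>\<omega>. \<lambda>i\<in>{1..<Suc (Suc n)}. X i \<omega>)"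
      by (rule indep_var_restrict) auto
    from indep_var_compose[OF this E H]
    have "indep_var borel (\<lambda>\<omega>. exp (X 0 \<omega> - \<phi>)) borel (\<lambda>\<omega>. H (\<lambda>i\<in>{1..<Suc (Suc n)}. X i \<omega>))"
      by (simp add: comp_def)
    moreover have "H (\<lambda>i\<in>{1..<Suc (Suc n)}. x i) = G (\<lambda>i. x (1 + i))" for x
      unfolding H_def G_def by (intro arg_cong[where f = Max] image_cong) auto
    ultimately show ?thesis
      by simp
  qed
  have V_X: "V k \<omega> = B (\<delta> * real k) \<omega> - \<phi> * real k" for k \<omega>
    by (simp add: V_def \<phi>_def)
  have "(\<integral>\<omega>. (MAX k\<in>{..n}. exp (V (Suc k) \<omega>)) \<partial>M) = (\<integral>\<omega>. exp (X 0 \<omega> - \<phi>) * G (\<lambda>i. X (1 + i) \<omega>) \<partial>M)"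
  proof (rule integral_cong_AE)
    show "AE \<omega> in M. (MAX k\<in>{..n}. exp (V (Suc k) \<omega>)) = exp (X 0 \<omega> - \<phi>) * G (\<lambda>i. X (1 + i) \<omega>)"
      using AE_B_0
    proof eventually_elim
      case (elim \<omega>)
      have "V (Suc k) \<omega> = (X 0 \<omega> - \<phi>) + (B (\<delta> * real (1 + k)) \<omega> - B (\<delta> * real 1) \<omega> - \<phi> * real k)" for k
        using elim by (simp add: V_X X_def distrib_left)
      then show ?case
        unfolding G_X by (simp only: Max_exp_add)
    qed
    show "(\<lambda>\<omega>. MAX k\<in>{..n}. exp (V (Suc k) \<omega>)) \<in> borel_measurable M"
      unfolding V_X by (intro borel_measurable_Max finite_atMost; measurable)
    show "(\<lambda>\<omega>. exp (X 0 \<omega> - \<phi>) * G (\<lambda>i. X (1 + i) \<omega>)) \<in> borel_measurable M"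
      unfolding G_X by (intro borel_measurable_times borel_measurable_Max finite_atMost; measurable)
  qed
  also have "\<dots> = (\<integral>\<omega>. G (\<lambda>i. X (1 + i) \<omega>) \<partial>M)"
    using indep_var_lebesgue_integral[OF ind B\<delta>(2) G_int] B\<delta>(1) by simp
  \<comment> \<open>By \<open>G_law\<close> the offset may be moved from 1 back to 0.\<close>
  also have "\<dots> = (\<integral>\<omega>. G (\<lambda>i. X (0 + i) \<omega>) \<partial>M)"
    unfolding G_law ..
  also have "\<dots> = (\<integral>\<omega>. (MAX k\<in>{..n}. exp (V k \<omega>)) \<partial>M)"
  proof (rule integral_cong_AE)
    show "AE \<omega> in M. G (\<lambda>i. X (0 + i) \<omega>) = (MAX k\<in>{..n}. exp (V k \<omega>))"
      using AE_B_0 unfolding G_X by eventually_elim (simp add: V_X)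
    show "(\<lambda>\<omega>. G (\<lambda>i. X (0 + i) \<omega>)) \<in> borel_measurable M"
      unfolding G_X by (intro borel_measurable_Max finite_atMost; measurable)
    show "(\<lambda>\<omega>. MAX k\<in>{..n}. exp (V k \<omega>)) \<in> borel_measurable M"
      unfolding V_X by (intro borel_measurable_Max finite_atMost; measurable)
  qed
  finally show ?thesis .
qed

end

section \<open>Lower bounds for the Pickands constants\<close>

text \<open>The series in the Gaussian case may diverge. In \<open>ereal\<close> its sum is then
  infinite and the bound reads 0, whereas a real-valued \<open>suminf\<close> would be unspecified.
  Convergence of the means is asserted as well, since it gives \<open>pickands_constant\<close> its
  meaning.\<close>

theorem theorem3p1:
  fixes M :: "'a measure" and B W :: "real \<Rightarrow> 'a \<Rightarrow> real" and \<delta> :: real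
  assumes "prob_space M" and "\<delta> > 0"
  shows
    "(\<forall>var :: real \<Rightarrow> real.
        gaussian_process M B \<and> centered M B \<and> stationary_increments M B \<and> cadlag_paths M B \<and>
        (\<forall>t\<ge>0. var t = prob_space.variance M (B t)) \<and> var 0 = 0 \<and>
        (\<forall>t\<ge>0. \<forall>\<omega>. W t \<omega> = B t \<omega> - var t / 2)
      \<longrightarrow>
        (pickands_mean M W \<delta> \<longlongrightarrow> pickands_constant M W \<delta>) at_top \<and>
        ereal (pickands_constant M W \<delta>) \<ge>
          ereal (1 / \<delta>) * max 0 (1 - (\<Sum>k. ereal (exp (- var (\<delta> * real (Suc k)) / 8)))))
     \<and>
     (\<forall>\<Phi> :: real \<Rightarrow> real.
        levy_process M B \<and> \<Phi> = laplace_exponent M B \<and> integrable M (\<lambda>\<omega>. exp (B 1 \<omega>)) \<and>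
        (\<forall>t\<ge>0. \<forall>\<omega>. W t \<omega> = B t \<omega> - \<Phi> 1 * t)
      \<longrightarrow>
        (pickands_mean M W \<delta> \<longlongrightarrow> pickands_constant M W \<delta>) at_top \<and>
        pickands_constant M W \<delta> \<ge>
          1 / \<delta> * (max 0 (1 - 2 * exp ((\<Phi> (1/2) - 1/2 * \<Phi> 1) * \<delta>))
                    / (1 - exp ((\<Phi> (1/2) - 1/2 * \<Phi> 1) * \<delta>))))"
proof (intro conjI allI impI; elim conjE)
  fix var :: "real \<Rightarrow> real"
  assume A: "gaussian_process M B" "centered M B" "stationary_increments M B"
    "\<forall>t\<ge>0. var t = prob_space.variance M (B t)" "var 0 = 0"
    and W: "\<forall>t\<ge>0. \<forall>\<omega>. W t \<omega> = B t \<omega> - var t / 2"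
  interpret stationary_gaussian_grid M B var \<delta>
    using assms A by (simp add: stationary_gaussian_grid_def stationary_gaussian_grid_axioms_def)
  have W': "W (\<delta> * real k) \<omega> = B (\<delta> * real k) \<omega> - var (\<delta> * real k) / 2" for k \<omega>
    using W assms(2) by simp
  have mom: "integrable M (\<lambda>\<omega>. exp (r * W (\<delta> * real k) \<omega>))"
    "(\<integral>\<omega>. exp (r * W (\<delta> * real k) \<omega>) \<partial>M) = exp (r * (r - 1) * var (\<delta> * real k) / 2)" for r k
    unfolding W' using exp_moments[of "\<delta> * real k" r] assms(2) by simp_all
  obtain d where d: "(\<lambda>n. (\<integral>\<omega>. (MAX k\<in>{..n}. exp (W (\<delta> * real k) \<omega>)) \<partial>M) / real n) \<longlonglongrightarrow> d" "0 \<le> d"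
    "\<And>c. (\<And>n. c \<le> 1 - (\<Sum>k<n. \<integral>\<omega>. exp (W (\<delta> * real (Suc k)) \<omega> / 2) \<partial>M)) \<Longrightarrow> c \<le> d"
  proof (rule shift_invariant_max_rate[of M "\<lambda>k. W (\<delta> * real k)"])
    show "AE \<omega> in M. W (\<delta> * real 0) \<omega> = 0"
      using AE_B_0 by eventually_elim (unfold W', simp add: var_0)
    show "(\<integral>\<omega>. (MAX k\<in>{..n}. exp (W (\<delta> * real (Suc k)) \<omega>)) \<partial>M)
        = (\<integral>\<omega>. (MAX k\<in>{..n}. exp (W (\<delta> * real k) \<omega>)) \<partial>M)" for n :: nat
      unfolding W' by (rule shift_invariance)
  qed (use assms mom(1)[of 1] mom(1)[of "1 / 2"] in simp_all)
  note lim = pickands_mean_tendsto[OF assms(2) d(1)]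
  show "(pickands_mean M W \<delta> \<longlongrightarrow> pickands_constant M W \<delta>) at_top"
    using lim by simp
  define S where "S = (\<Sum>k. ereal (exp (- var (\<delta> * real (Suc k)) / 8)))"
  have partial: "ereal (\<Sum>k<n. \<integral>\<omega>. exp (W (\<delta> * real (Suc k)) \<omega> / 2) \<partial>M) \<le> S" for n
  proof -
    have half: "(\<integral>\<omega>. exp (W (\<delta> * real (Suc k)) \<omega> / 2) \<partial>M) = exp (- var (\<delta> * real (Suc k)) / 8)" for k
      using mom(2)[of "1 / 2" "Suc k"] by simp
    show ?thesis
      unfolding S_def half sum_ereal[symmetric] by (rule suminf_upper) simp
  qed
  \<comment> \<open>For a divergent series only 0 \<le> d is claimed; the value minus infinity is
    excluded by the empty partial sum.\<close>
  have "max 0 (1 - S) \<le> ereal d"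
  proof (cases S)
    case (real r)
    then have "1 - r \<le> d"
      using partial by (intro d(3)) (simp add: algebra_simps)
    with real \<open>0 \<le> d\<close> show ?thesis
      by (simp add: one_ereal_def)
  next
    case PInf
    with \<open>0 \<le> d\<close> show ?thesis
      by (simp add: one_ereal_def)
  next
    case MInf
    with partial[of 0] show ?thesis
      by simp
  qed
  then have "ereal (1 / \<delta>) * max 0 (1 - S) \<le> ereal (1 / \<delta>) * ereal d"
    using assms(2) by (intro ereal_mult_left_mono) auto
  then show "ereal (1 / \<delta>) * max 0 (1 - (\<Sum>k. ereal (exp (- var (\<delta> * real (Suc k)) / 8))))
      \<le> ereal (pickands_constant M W \<delta>)"
    unfolding S_def lim(2) by simp
next
  fix \<Phi> :: "real \<Rightarrow> real"
  assume A: "levy_process M B" and \<Phi>: "\<Phi> = laplace_exponent M B"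
    and int1: "integrable M (\<lambda>\<omega>. exp (B 1 \<omega>))"
    and W: "\<forall>t\<ge>0. \<forall>\<omega>. W t \<omega> = B t \<omega> - \<Phi> 1 * t"
  interpret levy M B
    using assms A by (simp add: levy_def levy_axioms_def)
  have W': "W (\<delta> * real k) \<omega> = B (\<delta> * real k) \<omega> - \<Phi> 1 * (\<delta> * real k)" for k \<omega>
    using W assms(2) by simp
  \<comment> \<open>Finiteness of \<Phi>(1/2) follows from that of \<Phi>(1) through sqrt x \<le> 1
    + x.\<close>
  have int_half: "integrable M (\<lambda>\<omega>. exp (1 / 2 * B 1 \<omega>))"
  proof (rule Bochner_Integration.integrable_bound)
    show "integrable M (\<lambda>\<omega>. 1 + exp (B 1 \<omega>))"
      using int1 by simp
    show "(\<lambda>\<omega>. exp (1 / 2 * B 1 \<omega>)) \<in> borel_measurable M"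
      using B_measurable[of 1] by simp
    have "exp (x / 2) \<le> 1 + exp x" for x :: real
      using one_minus_exp_le[of x] by (cases "x \<le> 0") (simp_all add: add_increasing add_increasing2)
    then show "AE \<omega> in M. norm (exp (1 / 2 * B 1 \<omega>)) \<le> norm (1 + exp (B 1 \<omega>))"
      by (simp add: add_nonneg_nonneg)
  qed
  have mom: "integrable M (\<lambda>\<omega>. exp (r * W (\<delta> * real k) \<omega>))"
    "(\<integral>\<omega>. exp (r * W (\<delta> * real k) \<omega>) \<partial>M) = exp ((\<Phi> r - r * \<Phi> 1) * \<delta>) ^ k"
    if "integrable M (\<lambda>\<omega>. exp (r * B 1 \<omega>))" for r k
  proof -
    have eq: "exp (r * W (\<delta> * real k) \<omega>) = exp (- r * \<Phi> 1 * \<delta> * real k) * exp (r * B (\<delta> * real k) \<omega>)" for \<omega>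
      unfolding W' by (simp add: mult_exp_exp algebra_simps)
    have B: "integrable M (\<lambda>\<omega>. exp (r * B (\<delta> * real k) \<omega>))"
      "(\<integral>\<omega>. exp (r * B (\<delta> * real k) \<omega>) \<partial>M) = exp (\<delta> * real k * \<Phi> r)"
      using exp_moments[OF that, of "\<delta> * real k"] assms(2) by (simp_all add: \<Phi>)
    show "integrable M (\<lambda>\<omega>. exp (r * W (\<delta> * real k) \<omega>))"
      unfolding eq using B(1) by simp
    show "(\<integral>\<omega>. exp (r * W (\<delta> * real k) \<omega>) \<partial>M) = exp ((\<Phi> r - r * \<Phi> 1) * \<delta>) ^ k"
      unfolding eq integral_mult_right_zero B(2)
      by (simp only: mult_exp_exp exp_of_nat_mult[symmetric]) (simp add: algebra_simps)
  qed
  obtain d where d: "(\<lambda>n. (\<integral>\<omega>. (MAX k\<in>{..n}. exp (W (\<delta> * real k) \<omega>)) \<partial>M) / real n) \<longlonglongrightarrow> d" "0 \<le> d"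
    "\<And>c. (\<And>n. c \<le> 1 - (\<Sum>k<n. \<integral>\<omega>. exp (W (\<delta> * real (Suc k)) \<omega> / 2) \<partial>M)) \<Longrightarrow> c \<le> d"
  proof (rule shift_invariant_max_rate[of M "\<lambda>k. W (\<delta> * real k)"])
    show "AE \<omega> in M. W (\<delta> * real 0) \<omega> = 0"
      using AE_B_0 by eventually_elim (unfold W', simp)
    show "(\<integral>\<omega>. (MAX k\<in>{..n}. exp (W (\<delta> * real (Suc k)) \<omega>)) \<partial>M)
        = (\<integral>\<omega>. (MAX k\<in>{..n}. exp (W (\<delta> * real k) \<omega>)) \<partial>M)" for n :: nat
      unfolding W' \<Phi> using int1 assms(2) by (rule shift_invariance)
  qed (use assms mom(1)[of 1] mom(1)[of "1 / 2"] int1 int_half in simp_all)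
  note lim = pickands_mean_tendsto[OF assms(2) d(1)]
  show "(pickands_mean M W \<delta> \<longlongrightarrow> pickands_constant M W \<delta>) at_top"
    using lim by simp
  define q where "q = exp ((\<Phi> (1/2) - 1/2 * \<Phi> 1) * \<delta>)"
  have half: "(\<integral>\<omega>. exp (W (\<delta> * real (Suc k)) \<omega> / 2) \<partial>M) = q ^ Suc k" for k
    using mom(2)[OF int_half, of "Suc k"] by (simp add: q_def)
  \<comment> \<open>For 2 q \<ge> 1 the numerator is 0 and so is the quotient, also at q = 1, where
    division by zero yields 0.\<close>
  have "max 0 (1 - 2 * q) / (1 - q) \<le> d"
  proof (cases "2 * q < 1")
    case True
    have q: "0 < q"
      by (simp add: q_def)
    \<comment> \<open>The geometric partial sums starting at q stay below q / (1 - q), and 1 minus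
      this is the left side.\<close>
    have "(1 - 2 * q) / (1 - q) \<le> d"
    proof (rule d(3))
      fix n
      have "(\<Sum>k<n. q ^ Suc k) = q * (\<Sum>k<n. q ^ k)"
        by (simp add: sum_distrib_left)
      also have "\<dots> \<le> q * (1 / (1 - q))"
        using True q by (intro mult_left_mono) (simp_all add: sum_gp_strict divide_right_mono)
      finally show "(1 - 2 * q) / (1 - q) \<le> 1 - (\<Sum>k<n. \<integral>\<omega>. exp (W (\<delta> * real (Suc k)) \<omega> / 2) \<partial>M)"
        unfolding half using True q by (simp add: field_simps)
    qed
    with True show ?thesis
      by simp
  qed (use \<open>0 \<le> d\<close> in simp)
  then have "1 / \<delta> * (max 0 (1 - 2 * q) / (1 - q)) \<le> 1 / \<delta> * d"
    using assms(2) by (intro mult_left_mono) auto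
  then show "1 / \<delta> * (max 0 (1 - 2 * exp ((\<Phi> (1/2) - 1/2 * \<Phi> 1) * \<delta>))
        / (1 - exp ((\<Phi> (1/2) - 1/2 * \<Phi> 1) * \<delta>))) \<le> pickands_constant M W \<delta>"
    unfolding q_def lim(2) by simp
qed

end
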